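(* Let $G$ be a connected graph with set of blocks $\mathcal{B}$, and let $$\mathcal{P}(G)=\{x\in[0,1]^{\mathcal{B}} \mid x \text{ satisfies all independent blocks inequalities of } G\}.$$ Then $\mathrm{CBP}(G)=\mathcal{P}(G)$. In particular, the independent blocks inequalities together with the nonnegativity constraints $x_B\ge 0$ ($B\in\mathcal{B}$) yield the complete and irredundant facet description of $\mathrm{CBP}(G)$ (i.e., these inequalities describe $\mathrm{CBP}(G)$, each of them defines a facet, and none of them can be omitted).
   Context: Graphs are finite, simple and undirected. A connected graph is 2-connected if it has at least three vertices and remains connected after deleting any single vertex. A bridge is an edge whose deletion increases the number of connected components. A block of $G$ is a maximal 2-connected subgraph of $G$ or a bridge together with its two end vertices; $\mathcal{B}$ denotes the set of blocks of $G$. For $\mathcal{A}\subseteq\mathcal{B}$ let $G[\mathcal{A}]=\bigcup_{B\in\mathcal{A}}B$ (the empty graph counts as connected), and let $\chi^{\mathcal{A}}\in\{0,1\}^{\mathcal{B}}$ be the incidence vector of $\mathcal{A}$. The connected blocks polytope is $\mathrm{CBP}(G)=\mathrm{conv}\{\chi^{\mathcal{A}}\mid \mathcal{A}\subseteq\mathcal{B},\ G[\mathcal{A}]\text{ connected}\}\subseteq\mathbb{R}^{\mathcal{B}}$. For $\mathcal{A}\subseteq\mathcal{B}$, $\mathcal{B}\langle\mathcal{A}\rangle$ denotes the smallest set of blocks that contains $\mathcal{A}$ and induces a connected subgraph of $G$. A set $\mathcal{I}\subseteq\mathcal{B}$ is an independent set of blocks if no two distinct blocks in $\mathcal{I}$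 share a vertex. Given an independent set of blocks $\mathcal{I}$, an inequality $\sum_{B\in\mathcal{B}}\alpha_Bx_B\le 1$ is called an independent blocks inequality, denoted $(\mathcal{I},\alpha)$, if: $\alpha_B=0$ for $B\notin\mathcal{B}\langle\mathcal{I}\rangle$; $\alpha_B=1$ for $B\in\mathcal{I}$; $\alpha_B\in\mathbb{Z}_{\le0}$ for $B\in\mathcal{B}\langle\mathcal{I}\rangle\setminus\mathcal{I}$; $\sum_{B\in\mathcal{B}\langle\mathcal{I}\rangle\setminus\mathcal{I}}\alpha_B=-(|\mathcal{I}|-1)$; and for all $I\subseteq\mathcal{I}$, $\sum_{B\in\mathcal{B}\langle I\rangle\setminus\mathcal{I}}\alpha_B\le-(|I|-1)$. *)

theory Defs
  imports "HOL-Analysis.Analysis"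
begin

text \<open>
  A graph is a pair of a vertex set and a set of edges, an edge being the set of its two end
  vertices. Graphs live on a finite type of vertices, but the vertex set may be any subset of it.
  Then the type of graphs is itself finite, so that vectors can be indexed by graphs and in
  particular by blocks.
\<close>

type_synonym 'a ugraph = "'a set \<times> 'a set set"

abbreviation verts :: "'a ugraph \<Rightarrow> 'a set" where "verts G \<equiv> fst G"
abbreviation edges :: "'a ugraph \<Rightarrow> 'a set set" where "edges G \<equiv> snd G"

definition simple_graph :: "'a ugraph \<Rightarrow> bool" where
  "simple_graph G \<longleftrightarrow> finite (verts G) \<and>
     (\<forall>e \<in> edges G. \<exists>u \<in> verts G. \<exists>v \<in> verts G. u \<noteq> v \<and> e = {u, v})"

definition subgraph :: "'a ugraph \<Rightarrow> 'a ugraph \<Rightarrow> bool" where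
  "subgraph H G \<longleftrightarrow> simple_graph H \<and> verts H \<subseteq> verts G \<and> edges H \<subseteq> edges G"

definition delete_vertex :: "'a ugraph \<Rightarrow> 'a \<Rightarrow> 'a ugraph" where
  "delete_vertex G v = (verts G - {v}, {e \<in> edges G. v \<notin> e})"

definition delete_edge :: "'a ugraph \<Rightarrow> 'a set \<Rightarrow> 'a ugraph" where
  "delete_edge G e = (verts G, edges G - {e})"

definition reachable :: "'a ugraph \<Rightarrow> ('a \<times> 'a) set" where
  "reachable G = {(u, v). {u, v} \<in> edges G}\<^sup>* \<inter> verts G \<times> verts G"

text \<open>The empty graph counts as connected.\<close>

definition connected_graph :: "'a ugraph \<Rightarrow> bool" where
  "connected_graph G \<longleftrightarrow> (\<forall>u \<in> verts G. \<forall>v \<in> verts G. (u, v) \<in> reachable G)"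

definition components_of_graph :: "'a ugraph \<Rightarrow> 'a set set" where
  "components_of_graph G = verts G // reachable G"

definition two_connected :: "'a ugraph \<Rightarrow> bool" where
  "two_connected G \<longleftrightarrow> connected_graph G \<and> card (verts G) \<ge> 3 \<and>
     (\<forall>v \<in> verts G. connected_graph (delete_vertex G v))"

definition bridge :: "'a ugraph \<Rightarrow> 'a set \<Rightarrow> bool" where
  "bridge G e \<longleftrightarrow> e \<in> edges G \<and>
     card (components_of_graph G) < card (components_of_graph (delete_edge G e))"

definition maximal_two_connected :: "'a ugraph \<Rightarrow> 'a ugraph \<Rightarrow> bool" where
  "maximal_two_connected G H \<longleftrightarrow> subgraph H G \<and> two_connected H \<and>
     (\<forall>K. subgraph K G \<and> two_connected K \<and> subgraph H K \<longrightarrow> K = H)"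

definition blocks :: "'a ugraph \<Rightarrow> 'a ugraph set" where
  "blocks G = {H. maximal_two_connected G H} \<union> {(e, {e}) | e. bridge G e}"

definition union_of_blocks :: "'a ugraph set \<Rightarrow> 'a ugraph" where
  "union_of_blocks A = (\<Union>(verts ` A), \<Union>(edges ` A))"

text \<open>\<open>LEAST\<close> is with respect to inclusion; the least set exists if \<open>G\<close> is connected and \<open>A\<close> consists of blocks of \<open>G\<close>.\<close>

definition block_closure :: "'a ugraph \<Rightarrow> 'a ugraph set \<Rightarrow> 'a ugraph set" where
  "block_closure G A = (LEAST C. A \<subseteq> C \<and> C \<subseteq> blocks G \<and> connected_graph (union_of_blocks C))"

definition independent_blocks :: "'a ugraph \<Rightarrow> 'a ugraph set \<Rightarrow> bool" where
  "independent_blocks G I \<longleftrightarrow> I \<subseteq> blocks G \<and>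
     (\<forall>B \<in> I. \<forall>C \<in> I. B \<noteq> C \<longrightarrow> verts B \<inter> verts C = {})"

text \<open>
  \<open>block_space G\<close> is the space of real vectors indexed by the blocks of \<open>G\<close>, embedded as a coordinate
  subspace into the vectors indexed by all graphs. It is the zero space if \<open>G\<close> has no
  blocks.
\<close>

definition block_space :: "'a::finite ugraph \<Rightarrow> (real ^ 'a ugraph) set" where
  "block_space G = {x. \<forall>B. B \<notin> blocks G \<longrightarrow> x $ B = 0}"

definition incidence_vector :: "'a::finite ugraph set \<Rightarrow> real ^ 'a ugraph" where
  "incidence_vector A = (\<chi> B. if B \<in> A then 1 else 0)"

definition CBP :: "'a::finite ugraph \<Rightarrow> (real ^ 'a ugraph) set" where
  "CBP G = convex hull
     {incidence_vector A | A. A \<subseteq> blocks G \<and> connected_graph (union_of_blocks A)}"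

text \<open>
  The coefficient vector is required to lie in \<open>block_space G\<close>, so that distinct coefficient vectors
  are distinct inequalities on that space.
\<close>

definition independent_blocks_inequality ::
    "'a::finite ugraph \<Rightarrow> 'a ugraph set \<Rightarrow> real ^ 'a ugraph \<Rightarrow> bool" where
  "independent_blocks_inequality G I \<alpha> \<longleftrightarrow>
     independent_blocks G I \<and> \<alpha> \<in> block_space G \<and>
     (\<forall>B \<in> blocks G - block_closure G I. \<alpha> $ B = 0) \<and>
     (\<forall>B \<in> I. \<alpha> $ B = 1) \<and>
     (\<forall>B \<in> block_closure G I - I. \<alpha> $ B \<in> \<int> \<and> \<alpha> $ B \<le> 0) \<and>
     (\<Sum>B \<in> block_closure G I - I. \<alpha> $ B) = - (real (card I) - 1) \<and>
     (\<forall>J \<subseteq> I. (\<Sum>B \<in> block_closure G J - I. \<alpha> $ B) \<le> - (real (card J) - 1))"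

definition independent_blocks_polytope :: "'a::finite ugraph \<Rightarrow> (real ^ 'a ugraph) set" where
  "independent_blocks_polytope G =
     {x \<in> block_space G. (\<forall>B \<in> blocks G. 0 \<le> x $ B \<and> x $ B \<le> 1) \<and>
        (\<forall>I \<alpha>. independent_blocks_inequality G I \<alpha> \<longrightarrow> (\<Sum>B \<in> blocks G. \<alpha> $ B * x $ B) \<le> 1)}"

text \<open>A pair \<open>(a, b)\<close> stands for the linear inequality \<open>a \<bullet> x \<le> b\<close>.\<close>

definition solutions ::
    "'a::finite ugraph \<Rightarrow> ((real ^ 'a ugraph) \<times> real) set \<Rightarrow> (real ^ 'a ugraph) set" where
  "solutions G S = {x \<in> block_space G. \<forall>(a, b) \<in> S. a \<bullet> x \<le> b}"

definition facet_defining ::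
    "'v::euclidean_space set \<Rightarrow> 'v \<times> real \<Rightarrow> bool" where
  "facet_defining P = (\<lambda>(a, b). (\<forall>x \<in> P. a \<bullet> x \<le> b) \<and> {x \<in> P. a \<bullet> x = b} facet_of P)"

text \<open>
  The bounds \<open>x $ B \<le> 1\<close> are not listed separately: they are the independent blocks
  inequalities with \<open>I = {B}\<close>.
\<close>

definition CBP_system :: "'a::finite ugraph \<Rightarrow> ((real ^ 'a ugraph) \<times> real) set" where
  "CBP_system G = {(\<alpha>, 1) | \<alpha>. \<exists>I. independent_blocks_inequality G I \<alpha>} \<union>
     {(- axis B 1, 0) | B. B \<in> blocks G}"

end

theory Submission
  imports Defs "HOL-Library.Transitive_Closure_Table"
begin

text \<open>
  The blocks of \<open>G\<close> form a hypertree: a connected set of blocks meets any other block in at most one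
  vertex, since two common vertices would give an ear enlarging that block. Hence a nonempty
  connected set \<open>C\<close> satisfies \<open>card C = 1 + (\<Sum>v. deg v - 1)\<close>, the sum ranging over its vertices.

  Choose for each vertex \<open>v\<close> a block \<open>f v\<close> containing it and put
  \<open>\<alpha>\<^sup>f B = 1 - card {v \<in> B. f v \<noteq> B}\<close>. The counting formula shows that \<open>\<alpha>\<^sup>f\<close> sums to at most 1 over
  every connected set, and to exactly 1 if the set contains \<open>f v\<close> along with each of its vertices \<open>v\<close>.
  The independent blocks inequalities are precisely the inequalities \<open>\<alpha>\<^sup>f \<bullet> x \<le> 1\<close>; integrality is used
  here, by induction on leaves of the hypertree.

  If \<open>x \<ge> 0\<close> and \<open>f v\<close> is a block at \<open>v\<close> where \<open>x\<close> is maximal, then peeling off components of the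
  support writes \<open>x\<close> as a nonnegative combination of incidence vectors of connected sets closed under
  \<open>f\<close>, with total weight \<open>\<alpha>\<^sup>f \<bullet> x\<close>; this is the description of the polytope. For the facets, the sets
  reachable from single blocks under \<open>B \<mapsto> f v\<close>, \<open>v \<in> B\<close>, are tight for \<open>\<alpha>\<^sup>f\<close> and form a triangular
  system because this relation has no cycles.
\<close>

section \<open>Ears and blocks\<close>

definition adj :: "'a set set \<Rightarrow> 'a set \<Rightarrow> ('a \<times> 'a) set" where
  "adj E Z = {(a, b). {a, b} \<in> E \<and> a \<notin> Z \<and> b \<notin> Z}"

text \<open>Two vertices suffice here, so that 2-connected graphs and single edges are treated alike
  and both kinds of block become maximal graphs of one class. Deleting nothing and deleting one
  vertex are merged into the choice of \<open>Z\<close>.\<close>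

definition nonsep :: "'a ugraph \<Rightarrow> bool" where
  "nonsep H \<longleftrightarrow> card (verts H) \<ge> 2 \<and>
     (\<forall>Z. finite Z \<and> card Z \<le> 1 \<longrightarrow>
       (\<forall>x \<in> verts H - Z. \<forall>y \<in> verts H - Z. (x, y) \<in> (adj (edges H) Z)\<^sup>*))"

lemma adj_rtrancl_sym: "(a, b) \<in> (adj E Z)\<^sup>* \<Longrightarrow> (b, a) \<in> (adj E Z)\<^sup>*"
  by (rule symD[OF sym_rtrancl]) (auto simp: sym_def adj_def insert_commute)

lemma adj_rtrancl_mono: "(a, b) \<in> (adj E Z)\<^sup>* \<Longrightarrow> E \<subseteq> E' \<Longrightarrow> (a, b) \<in> (adj E' Z)\<^sup>*"
  by (erule rtrancl_mono[THEN subsetD, rotated]) (auto simp: adj_def)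

lemma nonsepD:
  "nonsep H \<Longrightarrow> finite Z \<Longrightarrow> card Z \<le> 1 \<Longrightarrow> x \<in> verts H - Z \<Longrightarrow> y \<in> verts H - Z \<Longrightarrow>
     (x, y) \<in> (adj (edges H) Z)\<^sup>*"
  by (auto simp: nonsep_def)

lemma nonsepI_hub:
  assumes "card (verts H) \<ge> 2"
    and "\<And>Z. finite Z \<Longrightarrow> card Z \<le> 1 \<Longrightarrow> \<exists>h. \<forall>x \<in> verts H - Z. (x, h) \<in> (adj (edges H) Z)\<^sup>*"
  shows "nonsep H"
  unfolding nonsep_def using assms by (meson adj_rtrancl_sym rtrancl_trans)

lemma simple_edge_verts: "simple_graph H \<Longrightarrow> {a, b} \<in> edges H \<Longrightarrow> a \<in> verts H \<and> b \<in> verts H \<and> a \<noteq> b"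
  by (fastforce simp: simple_graph_def doubleton_eq_iff)

lemma connected_graph_iff:
  "connected_graph H \<longleftrightarrow> (\<forall>x \<in> verts H. \<forall>y \<in> verts H. (x, y) \<in> (adj (edges H) {})\<^sup>*)"
  by (auto simp: connected_graph_def reachable_def adj_def)

lemma connected_delete_vertex_iff:
  "connected_graph (delete_vertex H v) \<longleftrightarrow>
     (\<forall>x \<in> verts H - {v}. \<forall>y \<in> verts H - {v}. (x, y) \<in> (adj (edges H) {v})\<^sup>*)"
proof -
  have "{(a, b). {a, b} \<in> edges (delete_vertex H v)} = adj (edges H) {v}"
    by (auto simp: adj_def delete_vertex_def)
  then show ?thesis
    by (auto simp: connected_graph_def reachable_def delete_vertex_def)
qed

lemma two_connected_iff_nonsep:
  assumes "simple_graph H"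
  shows "two_connected H \<longleftrightarrow> nonsep H \<and> card (verts H) \<ge> 3"
proof
  assume H: "two_connected H"
  have "(x, y) \<in> (adj (edges H) Z)\<^sup>*"
    if Z: "finite Z" "card Z \<le> 1" and xy: "x \<in> verts H - Z" "y \<in> verts H - Z" for Z x y
  proof -
    consider "Z = {}" | z where "Z = {z}"
      using Z by (metis card_1_singletonE card_eq_0_iff le_neq_implies_less less_one)
    then show ?thesis
    proof cases
      case 1
      then show ?thesis using H xy by (auto simp: two_connected_def connected_graph_iff)
    next
      case (2 z)
      show ?thesis
      proof (cases "z \<in> verts H")
        case True
        then show ?thesis using H xy 2 by (auto simp: two_connected_def connected_delete_vertex_iff)
      next
        case False
        \<comment> \<open>Edges of \<open>H\<close> only join vertices of \<open>H\<close>, so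
          deleting a vertex outside \<open>H\<close> changes nothing.\<close>
        then have "adj (edges H) Z = adj (edges H) {}"
          using simple_edge_verts[OF assms] 2 by (auto simp: adj_def)
        then show ?thesis using H xy by (auto simp: two_connected_def connected_graph_iff)
      qed
    qed
  qed
  then show "nonsep H \<and> card (verts H) \<ge> 3" using H by (auto simp: nonsep_def two_connected_def)
next
  assume "nonsep H \<and> card (verts H) \<ge> 3"
  then show "two_connected H"
    using nonsepD[of H "{}"] nonsepD[of H "{v}" for v]
    by (auto simp: two_connected_def connected_delete_vertex_iff connected_graph_iff[of H])
qed

text \<open>Of the two shared vertices at least one survives the deletion, and it serves as a hub
  for both graphs.\<close>

lemma nonsep_union:
  assumes H: "nonsep H" and K: "nonsep K" and fin: "finite (verts H)" "finite (verts K)"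
    and uv: "u \<in> verts H" "v \<in> verts H" "u \<in> verts K" "v \<in> verts K" "u \<noteq> v"
  shows "nonsep (verts H \<union> verts K, edges H \<union> edges K)"
proof (rule nonsepI_hub)
  show "2 \<le> card (verts (verts H \<union> verts K, edges H \<union> edges K))"
    using H fin card_mono[of "verts H \<union> verts K" "verts H"] by (auto simp: nonsep_def)
next
  fix Z :: "'a set" assume Z: "finite Z" "card Z \<le> 1"
  obtain w where w: "w \<in> {u, v} - Z"
    using uv(5) Z by (metis DiffI card_2_iff card_mono insert_iff not_less_eq_eq numeral_2_eq_2
        One_nat_def subsetI)
  have "(x, w) \<in> (adj (edges H \<union> edges K) Z)\<^sup>*" if "x \<in> verts H \<union> verts K - Z" for x
  proof (cases "x \<in> verts H")
    case True
    then show ?thesis using nonsepD[OF H Z, of x w] that w uv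
      by (auto intro: adj_rtrancl_mono[of _ _ "edges H"])
  next
    case False
    then show ?thesis using nonsepD[OF K Z, of x w] that w uv
      by (auto intro: adj_rtrancl_mono[of _ _ "edges K"])
  qed
  then show "\<exists>h. \<forall>x\<in>verts (verts H \<union> verts K, edges H \<union> edges K) - Z.
      (x, h) \<in> (adj (edges (verts H \<union> verts K, edges H \<union> edges K)) Z)\<^sup>*" by auto
qed

text \<open>
  A graph \<open>K\<close> obtained from \<open>H\<close> by attaching at \<open>u\<close> a path with tip \<open>p\<close>: after deleting at most one
  vertex, every vertex is still connected to \<open>H\<close> or to the tip, and the latter alternative is
  only needed if the deleted vertex lies on the path.
\<close>

definition partial_ear :: "'a ugraph \<Rightarrow> 'a \<Rightarrow> 'a ugraph \<Rightarrow> 'a \<Rightarrow> bool" where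
  "partial_ear H u K p \<longleftrightarrow> subgraph H K \<and> u \<in> verts H \<and> p \<in> verts K \<and> p \<in> insert u (verts K - verts H) \<and>
     (\<forall>Z. finite Z \<and> card Z \<le> 1 \<longrightarrow> (\<forall>x \<in> verts K - Z.
        (\<exists>h \<in> verts H - Z. (x, h) \<in> (adj (edges K) Z)\<^sup>*) \<or>
        Z \<inter> insert u (verts K - verts H) \<noteq> {} \<and> p \<notin> Z \<and> (x, p) \<in> (adj (edges K) Z)\<^sup>*))"

lemma partial_earD:
  assumes "partial_ear H u K p" "finite Z" "card Z \<le> 1" "x \<in> verts K - Z"
  obtains h where "h \<in> verts H - Z" "(x, h) \<in> (adj (edges K) Z)\<^sup>*"
  | "Z \<inter> insert u (verts K - verts H) \<noteq> {}" "p \<notin> Z" "(x, p) \<in> (adj (edges K) Z)\<^sup>*"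
  using assms unfolding partial_ear_def by blast

text \<open>If the deletion misses the old path, the new tip reaches \<open>H\<close> through the
  old tip. If it hits the path, whatever was connected to the old tip is now connected to the new
  one.\<close>

lemma partial_ear_extend:
  assumes ear: "partial_ear H u K p" and q: "q \<notin> verts K"
  shows "partial_ear H u (insert q (verts K), insert {p, q} (edges K)) q"
proof -
  let ?K = "(insert q (verts K), insert {p, q} (edges K))"
  have HK: "subgraph H K" and u: "u \<in> verts H" and p: "p \<in> verts K" "p \<in> insert u (verts K - verts H)"
    using ear by (auto simp: partial_ear_def)
  have mono: "(a, b) \<in> (adj (edges ?K) Z)\<^sup>*" if "(a, b) \<in> (adj (edges K) Z)\<^sup>*" for a b Z
    using that by (rule adj_rtrancl_mono) auto
  have "(\<exists>h \<in> verts H - Z. (x, h) \<in> (adj (edges ?K) Z)\<^sup>*) \<or>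
        Z \<inter> insert u (verts ?K - verts H) \<noteq> {} \<and> q \<notin> Z \<and> (x, q) \<in> (adj (edges ?K) Z)\<^sup>*"
    if Z: "finite Z" "card Z \<le> 1" and x: "x \<in> verts ?K - Z" for Z x
  proof (cases "x = q")
    case True
    show ?thesis
    proof (cases "Z \<inter> insert u (verts K - verts H) = {}")
      case True
      then have "p \<notin> Z" using p by blast
      with p have "p \<in> verts K - Z" by blast
      from ear Z this obtain h where "h \<in> verts H - Z" "(p, h) \<in> (adj (edges K) Z)\<^sup>*"
        by (rule partial_earD) (use True in auto)
      moreover have "(x, p) \<in> adj (edges ?K) Z" using \<open>x = q\<close> x \<open>p \<notin> Z\<close>
        by (auto simp: adj_def insert_commute)
      ultimately show ?thesis using mono by (meson converse_rtrancl_into_rtrancl)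
    next
      case False
      then show ?thesis using \<open>x = q\<close> x by auto
    qed
  next
    case False
    then have "x \<in> verts K - Z" using x by auto
    from ear Z this show ?thesis
    proof (cases rule: partial_earD)
      case (1 h)
      then show ?thesis using mono by blast
    next
      case 2
      \<comment> \<open>The only deleted vertex is already spent on the old path.\<close>
      have "q \<notin> Z"
      proof
        assume "q \<in> Z"
        moreover obtain z where "z \<in> Z" "z \<in> insert u (verts K - verts H)" using 2(1) by blast
        ultimately have "z = q" using Z by (metis card_le_Suc0_iff_eq One_nat_def)
        then show False using \<open>z \<in> insert u _\<close> q u HK by (auto simp: subgraph_def)
      qed
      moreover have "(p, q) \<in> adj (edges ?K) Z" using 2 \<open>q \<notin> Z\<close> by (auto simp: adj_def)
      ultimately show ?thesis using 2 mono by (fastforce intro: rtrancl_into_rtrancl)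
    qed
  qed
  moreover have "subgraph H ?K" using HK by (auto simp: subgraph_def)
  moreover have "q \<notin> verts H" using HK q by (auto simp: subgraph_def)
  ultimately show ?thesis using u unfolding partial_ear_def by auto
qed


text \<open>A vertex that could only reach the tip now continues to \<open>w\<close>. In that case
  the deleted vertex is \<open>u\<close> or lies on the path, so \<open>w\<close> itself
  survives.\<close>

lemma partial_ear_close:
  assumes ear: "partial_ear H u K p" and H: "nonsep H" and fin: "finite (verts K)"
    and w: "w \<in> verts H" "w \<noteq> u"
  shows "nonsep (verts K, insert {p, w} (edges K))"
proof (rule nonsepI_hub)
  let ?K = "(verts K, insert {p, w} (edges K))"
  have HK: "subgraph H K" using ear by (auto simp: partial_ear_def)
  show "2 \<le> card (verts ?K)"
    using H HK fin card_mono[of "verts K" "verts H"] by (auto simp: nonsep_def subgraph_def)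
  fix Z :: "'a set" assume Z: "finite Z" "card Z \<le> 1"
  obtain h0 where h0: "h0 \<in> verts H - Z"
  proof -
    have "\<not> verts H \<subseteq> Z"
      using H Z card_mono[of Z "verts H"] by (auto simp: nonsep_def)
    then show ?thesis using that by blast
  qed
  have mono: "(a, b) \<in> (adj (edges ?K) Z)\<^sup>*" if "(a, b) \<in> (adj (edges K) Z)\<^sup>*" for a b
    using that by (rule adj_rtrancl_mono) auto
  have H': "(h, h0) \<in> (adj (edges ?K) Z)\<^sup>*" if "h \<in> verts H - Z" for h
    using nonsepD[OF H Z that h0] HK by (auto intro: adj_rtrancl_mono simp: subgraph_def)
  have "(x, h0) \<in> (adj (edges ?K) Z)\<^sup>*" if x: "x \<in> verts K - Z" for x
    using ear Z x
  proof (cases rule: partial_earD)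
    case (1 h)
    then show ?thesis using H' mono by (meson rtrancl_trans)
  next
    case 2
    have "w \<notin> Z"
    proof
      assume "w \<in> Z"
      moreover obtain z where "z \<in> Z" "z \<in> insert u (verts K - verts H)" using 2(1) by blast
      ultimately have "z = w" using Z by (metis card_le_Suc0_iff_eq One_nat_def)
      then show False using \<open>z \<in> insert u _\<close> w by auto
    qed
    then have "(p, w) \<in> adj (edges ?K) Z" using 2 by (auto simp: adj_def)
    moreover have "(w, h0) \<in> (adj (edges ?K) Z)\<^sup>*" using H' w \<open>w \<notin> Z\<close> by blast
    ultimately show ?thesis using mono[OF 2(3)]
      by (meson converse_rtrancl_into_rtrancl rtrancl_trans)
  qed
  then show "\<exists>h. \<forall>x\<in>verts ?K - Z. (x, h) \<in> (adj (edges ?K) Z)\<^sup>*" by auto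
qed

text \<open>The path is followed until it first returns to \<open>K\<close>; by the condition on
  \<open>ps\<close> this happens at a vertex of \<open>H\<close> other than \<open>u\<close>, where
  the ear can be closed. That some edge of \<open>F\<close> is used is recorded because it makes the
  new graph differ from \<open>H\<close> in applications.\<close>

lemma partial_ear_path:
  assumes "rtrancl_path (\<lambda>a b. {a, b} \<in> F) p ps v" "distinct ps"
    and "partial_ear H u K p" "subgraph K G" "set ps \<inter> verts K \<subseteq> verts H - {u}"
    and "v \<in> verts H" "v \<noteq> u" "nonsep H" "F \<subseteq> edges G" "simple_graph G"
  shows "\<exists>K'. nonsep K' \<and> subgraph K' G \<and> subgraph H K' \<and> edges K' \<inter> F \<noteq> {}"
  using assms
proof (induction arbitrary: K rule: rtrancl_path.induct)
  \<comment> \<open>Vacuous: a tip is \<open>u\<close> or lies outside \<open>H\<close>, whereas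
    \<open>v\<close> is neither.\<close>
  case (base x)
  then show ?case by (auto simp: partial_ear_def)
next
  case (step p q ps v)
  let ?K = "(insert q (verts K), insert {p, q} (edges K))"
  have K: "simple_graph K" "verts K \<subseteq> verts G" "edges K \<subseteq> edges G" and G: "simple_graph G"
    and e: "{p, q} \<in> edges G" and HK: "subgraph H K" "p \<in> verts K"
    using step.prems step.hyps by (auto simp: subgraph_def partial_ear_def)
  have pq: "p \<in> verts G" "q \<in> verts G" "p \<noteq> q" using simple_edge_verts[OF G e] by auto
  have simple: "simple_graph ?K"
    unfolding simple_graph_def
  proof (intro conjI ballI)
    fix e assume "e \<in> edges ?K"
    then consider "e = {p, q}" | u v where "u \<in> verts K" "v \<in> verts K" "u \<noteq> v" "e = {u, v}"
      using K by (auto simp: simple_graph_def)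
    then show "\<exists>u\<in>verts ?K. \<exists>v\<in>verts ?K. u \<noteq> v \<and> e = {u, v}"
      by cases (use pq HK in auto)
  qed (use K in \<open>auto simp: simple_graph_def\<close>)
  have sub: "subgraph ?K G" "subgraph H ?K"
    using simple K HK pq e by (auto simp: subgraph_def)
  show ?case
  proof (cases "q \<in> verts K")
    case True
    then have q: "q \<in> verts H" "q \<noteq> u" using step.prems by auto
    have "nonsep (verts K, insert {p, q} (edges K))"
      using step.prems q K by (intro partial_ear_close) (auto simp: simple_graph_def)
    moreover have "insert q (verts K) = verts K" using True by auto
    ultimately show ?thesis using sub step.hyps
      by (intro exI[of _ ?K]) auto
  next
    case False
    have "\<exists>K'. nonsep K' \<and> subgraph K' G \<and> subgraph H K' \<and> edges K' \<inter> F \<noteq> {}"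
    proof (rule step.IH)
      show "partial_ear H u ?K q" using step.prems False by (intro partial_ear_extend)
      show "set ps \<inter> verts ?K \<subseteq> verts H - {u}" using step.prems by auto
    qed (use step.prems sub in auto)
    then show ?thesis .
  qed
qed

text \<open>After shortcutting the walk to a path with distinct vertices, the construction starts
  from the trivial partial ear \<open>H\<close> with tip \<open>u\<close>.\<close>

lemma ear_exists:
  assumes H: "nonsep H" "subgraph H G" and G: "simple_graph G" and F: "F \<subseteq> edges G"
    and uv: "u \<in> verts H" "v \<in> verts H" "u \<noteq> v" and path: "(u, v) \<in> (adj F {})\<^sup>*"
  obtains K where "nonsep K" "subgraph K G" "subgraph H K" "edges K \<inter> F \<noteq> {}"
proof -
  have "(\<lambda>a b. {a, b} \<in> F)\<^sup>*\<^sup>* u v"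
    using path by (simp add: adj_def rtrancl_def)
  then obtain ps where ps: "rtrancl_path (\<lambda>a b. {a, b} \<in> F) u ps v" "distinct (u # ps)"
    by (metis rtranclp_eq_rtrancl_path rtrancl_path_distinct)
  have "partial_ear H u H u"
    using H uv by (auto simp: partial_ear_def subgraph_def)
  moreover have "set ps \<inter> verts H \<subseteq> verts H - {u}" using ps(2) by auto
  ultimately have "\<exists>K. nonsep K \<and> subgraph K G \<and> subgraph H K \<and> edges K \<inter> F \<noteq> {}"
    using partial_ear_path[OF ps(1) _ _ H(2), of H u] ps(2) uv H G F by simp
  then show ?thesis using that by blast
qed

lemma nonsep_edge:
  fixes u v :: 'a
  assumes uv: "u \<noteq> v"
  shows "nonsep ({u, v}, {{u, v}})"
proof (rule nonsepI_hub)
  fix Z :: "'a set" assume Z: "finite Z" "card Z \<le> 1"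
  let ?H = "({u, v}, {{u, v}})"
  show "\<exists>h. \<forall>x\<in>verts ?H - Z. (x, h) \<in> (adj (edges ?H) Z)\<^sup>*"
  proof (cases "u \<in> Z")
    case True
    then show ?thesis by auto
  next
    case False
    then have "(v, u) \<in> adj (edges ?H) Z" if "v \<notin> Z" using that by (auto simp: adj_def insert_commute)
    then show ?thesis by auto
  qed
qed (use uv in auto)

lemma subgraph_finite: "subgraph H G \<Longrightarrow> finite (verts H)"
  by (auto simp: subgraph_def simple_graph_def)

section \<open>Bridges\<close>

lemma components_connected:
  assumes "connected_graph G" "v \<in> verts G"
  shows "components_of_graph G = {verts G}"
proof -
  have "reachable G `` {x} = verts G" if "x \<in> verts G" for x
    using assms that by (auto simp: connected_graph_def reachable_def)
  then show ?thesis using assms by (auto simp: components_of_graph_def quotient_def)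
qed

text \<open>A connected graph with an edge has exactly one component, so the count grows precisely
  when the two ends of the deleted edge fall into different classes.\<close>

lemma bridge_iff:
  assumes "simple_graph G" "connected_graph G" "{u, v} \<in> edges G"
  shows "bridge G {u, v} \<longleftrightarrow> (u, v) \<notin> (adj (edges G - {{u, v}}) {})\<^sup>*"
proof
  let ?D = "delete_edge G {u, v}"
  have uv: "u \<in> verts G" "v \<in> verts G" using simple_edge_verts[OF assms(1,3)] by auto
  have cG: "card (components_of_graph G) = 1"
    using components_connected[OF assms(2) uv(1)] by simp
  {
    assume "bridge G {u, v}"
    show "(u, v) \<notin> (adj (edges G - {{u, v}}) {})\<^sup>*"
    proof
      assume r: "(u, v) \<in> (adj (edges G - {{u, v}}) {})\<^sup>*"
      have "adj (edges G) {} \<subseteq> (adj (edges G - {{u, v}}) {})\<^sup>*"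
      proof (clarsimp simp: adj_def[of "edges G"])
        fix a b assume "{a, b} \<in> edges G"
        then show "(a, b) \<in> (adj (edges G - {{u, v}}) {})\<^sup>*"
          using r adj_rtrancl_sym[OF r]
          by (cases "{a, b} = {u, v}") (auto simp: doubleton_eq_iff adj_def)
      qed
      then have "(adj (edges G) {})\<^sup>* \<subseteq> (adj (edges G - {{u, v}}) {})\<^sup>*"
        by (metis rtrancl_idemp rtrancl_mono)
      then have "connected_graph ?D"
        using assms(2) by (auto simp: connected_graph_iff delete_edge_def)
      then have "components_of_graph ?D = {verts ?D}"
        by (rule components_connected) (use uv in \<open>auto simp: delete_edge_def\<close>)
      then show False using \<open>bridge G {u, v}\<close> cG by (auto simp: bridge_def)
    qed
  next
    assume r: "(u, v) \<notin> (adj (edges G - {{u, v}}) {})\<^sup>*"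
    let ?U = "reachable ?D `` {u}" and ?V = "reachable ?D `` {v}"
    have "v \<in> ?V" "v \<notin> ?U" using r uv by (auto simp: reachable_def delete_edge_def adj_def)
    then have "?U \<noteq> ?V" by blast
    moreover have "?U \<in> components_of_graph ?D" "?V \<in> components_of_graph ?D"
      using uv by (auto simp: components_of_graph_def quotient_def delete_edge_def)
    moreover have "finite (components_of_graph ?D)"
      using assms(1) by (auto simp: components_of_graph_def quotient_def simple_graph_def delete_edge_def)
    ultimately have "card {?U, ?V} \<le> card (components_of_graph ?D)"
      by (intro card_mono) auto
    then show "bridge G {u, v}" using \<open>?U \<noteq> ?V\<close> cG assms(3) by (auto simp: bridge_def)
  }
qed

text \<open>A third vertex \<open>z\<close> gives a detour: a walk from \<open>u\<close> to
  \<open>z\<close> avoiding \<open>v\<close>, then one from \<open>z\<close> to \<open>v\<close>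
  avoiding \<open>u\<close>. Neither part can use the edge \<open>{u, v}\<close>.\<close>

lemma nonsep_no_bridge:
  assumes "simple_graph G" "connected_graph G" "nonsep K" "subgraph K G" "card (verts K) \<ge> 3"
    and "e \<in> edges K"
  shows "\<not> bridge G e"
proof -
  have K: "simple_graph K" "edges K \<subseteq> edges G" using assms by (auto simp: subgraph_def)
  then obtain u v where e: "e = {u, v}" using assms(6) by (auto simp: simple_graph_def)
  have uv: "u \<in> verts K" "v \<in> verts K" "u \<noteq> v"
    using simple_edge_verts[OF K(1)] assms(6) e by auto
  have "\<not> verts K \<subseteq> {u, v}" using assms(5) card_mono[of "{u, v}" "verts K"] uv by auto
  then obtain z where z: "z \<in> verts K" "z \<noteq> u" "z \<noteq> v" by blast
  have mono: "(adj (edges K) {w})\<^sup>* \<subseteq> (adj (edges G - {{u, v}}) {})\<^sup>*" if "w \<in> {u, v}" for w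
    by (rule rtrancl_mono) (use K that in \<open>auto simp: adj_def doubleton_eq_iff\<close>)
  have "(u, z) \<in> (adj (edges K) {v})\<^sup>*" using assms(3) uv z by (intro nonsepD) auto
  moreover have "(z, v) \<in> (adj (edges K) {u})\<^sup>*" using assms(3) uv z by (intro nonsepD) auto
  ultimately have "(u, v) \<in> (adj (edges G - {{u, v}}) {})\<^sup>*"
    using mono[of u] mono[of v] by (auto intro: rtrancl_trans)
  then show ?thesis using bridge_iff[OF assms(1,2), of u v] K assms(6) e by auto
qed

lemma nonsep_card2_edges:
  assumes "simple_graph K" "card (verts K) < 3" "{u, v} \<subseteq> verts K" "u \<noteq> v"
  shows "verts K = {u, v}" "edges K \<subseteq> {{u, v}}"
proof -
  have "finite (verts K)" using assms(1) by (simp add: simple_graph_def)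
  then show "verts K = {u, v}"
    using assms by (intro card_seteq[symmetric]) auto
  then show "edges K \<subseteq> {{u, v}}" using assms(1) by (fastforce simp: simple_graph_def)
qed

section \<open>Blocks as maximal graphs without a separating vertex\<close>

context
  fixes G :: "'a ugraph"
  assumes G: "simple_graph G" "connected_graph G"
begin

lemma block_nonsep_subgraph:
  assumes "B \<in> blocks G" shows "nonsep B" "subgraph B G"
proof -
  have "nonsep B \<and> subgraph B G"
  proof (cases "maximal_two_connected G B")
    case True
    then show ?thesis
      using two_connected_iff_nonsep[of B] by (simp add: maximal_two_connected_def subgraph_def)
  next
    case False
    then obtain e where e: "B = (e, {e})" "bridge G e" using assms by (auto simp: blocks_def)
    then have "e \<in> edges G" by (simp add: bridge_def)
    then obtain u v where uv: "u \<in> verts G" "v \<in> verts G" "u \<noteq> v" "e = {u, v}"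
      using G by (auto simp: simple_graph_def)
    then show ?thesis using e \<open>e \<in> edges G\<close> nonsep_edge[of u v]
      by (auto simp: subgraph_def simple_graph_def)
  qed
  then show "nonsep B" "subgraph B G" by auto
qed

text \<open>Above a 2-connected block every candidate has at least three vertices and is again
  2-connected. Above a bridge no candidate has three vertices, since it would contain the
  bridge.\<close>

lemma block_maximal:
  assumes B: "B \<in> blocks G" and K: "nonsep K" "subgraph K G" "subgraph B K"
  shows "K = B"
proof (cases "maximal_two_connected G B")
  case True
  then have "card (verts B) \<ge> 3" by (simp add: maximal_two_connected_def two_connected_def)
  moreover have "card (verts B) \<le> card (verts K)"
    using K subgraph_finite[OF K(2)] by (intro card_mono) (auto simp: subgraph_def)
  ultimately have "two_connected K"
    using two_connected_iff_nonsep[of K] K by (auto simp: subgraph_def)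
  then show ?thesis using True K unfolding maximal_two_connected_def by blast
next
  case False
  then obtain e where e: "B = (e, {e})" "bridge G e" using B by (auto simp: blocks_def)
  then have "e \<in> edges G" by (simp add: bridge_def)
  then obtain u v where uv: "u \<noteq> v" "e = {u, v}"
    using G by (auto simp: simple_graph_def)
  have eK: "e \<in> edges K" "e \<subseteq> verts K" using K(3) e by (auto simp: subgraph_def)
  then have "card (verts K) < 3"
    using nonsep_no_bridge[OF G K(1,2)] e(2) by force
  then have "verts K = e" "edges K \<subseteq> {e}"
    using nonsep_card2_edges[of K u v] K eK uv by (auto simp: subgraph_def)
  then show ?thesis using e eK by (auto simp: prod_eq_iff)
qed

text \<open>If the edge is not a bridge, its ends are joined by a detour, which is an ear of the
  edge; the resulting 2-connected graph is then enlarged to a maximal one.\<close>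

lemma edge_in_block:
  assumes "e \<in> edges G" shows "\<exists>B \<in> blocks G. e \<in> edges B"
proof (cases "bridge G e")
  case True
  then have "(e, {e}) \<in> blocks G" by (auto simp: blocks_def)
  then show ?thesis by force
next
  case False
  obtain u v where uv: "u \<in> verts G" "v \<in> verts G" "u \<noteq> v" "e = {u, v}"
    using G assms by (auto simp: simple_graph_def)
  have "(u, v) \<in> (adj (edges G - {e}) {})\<^sup>*" using bridge_iff[OF G, of u v] False uv assms by auto
  moreover have "subgraph ({u, v}, {e}) G" using uv assms by (auto simp: subgraph_def simple_graph_def)
  ultimately obtain K where K: "nonsep K" "subgraph K G" "subgraph ({u, v}, {e}) K"
    "edges K \<inter> (edges G - {e}) \<noteq> {}"
    using ear_exists[of "({u, v}, {e})" G "edges G - {e}" u v] nonsep_edge[of u v] uv G by auto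
  \<comment> \<open>On two vertices \<open>e\<close> would be the only possible edge, but
    \<open>K\<close> contains another one.\<close>
  have "\<not> card (verts K) < 3"
    using nonsep_card2_edges(2)[of K u v] K uv by (auto simp: subgraph_def)
  then have K2: "two_connected K" using K two_connected_iff_nonsep[of K] by (auto simp: subgraph_def)
  define P where "P = {L. subgraph L G \<and> two_connected L \<and> subgraph K L}"
  have "finite (verts G)" using G by (simp add: simple_graph_def)
  moreover have "edges G \<subseteq> Pow (verts G)" using G by (auto simp: simple_graph_def)
  ultimately have fin: "finite (verts G)" "finite (edges G)" by (auto intro: finite_subset)
  from fin have "finite (Pow (verts G) \<times> Pow (edges G))" by simp
  moreover have "P \<subseteq> Pow (verts G) \<times> Pow (edges G)" by (auto simp: P_def subgraph_def)
  ultimately have "finite P" by (rule rev_finite_subset)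
  have "K \<in> P" using K K2 by (auto simp: P_def subgraph_def)
  \<comment> \<open>Counting vertices and edges together makes this measure strictly monotone for
    subgraphs.\<close>
  define size where "size L = card (verts L) + card (edges L)" for L :: "'a ugraph"
  have "Max (size ` P) \<in> size ` P" using \<open>finite P\<close> \<open>K \<in> P\<close> by (intro Max_in) auto
  then obtain L where L: "L \<in> P" "size L = Max (size ` P)" by force
  have max: "size M \<le> size L" if "M \<in> P" for M
    using that L(2) \<open>finite P\<close> by simp
  have "M = L" if M: "subgraph M G" "two_connected M" "subgraph L M" for M
  proof -
    have "M \<in> P" using L M by (auto simp: P_def subgraph_def)
    then have le: "card (verts M) + card (edges M) \<le> card (verts L) + card (edges L)"
      using max by (simp add: size_def)
    have finM: "finite (verts M)" "finite (edges M)"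
      using M fin by (auto simp: subgraph_def intro: finite_subset)
    have sub: "verts L \<subseteq> verts M" "edges L \<subseteq> edges M" using M by (auto simp: subgraph_def)
    have "card (verts L) \<le> card (verts M)" "card (edges L) \<le> card (edges M)"
      using sub finM by (auto intro: card_mono)
    then show ?thesis using le sub finM card_seteq[of "verts M" "verts L"] card_seteq[of "edges M" "edges L"]
      by (auto simp: prod_eq_iff)
  qed
  then have "L \<in> blocks G" using L by (auto simp: blocks_def maximal_two_connected_def P_def)
  moreover have "e \<in> edges L" using L K by (auto simp: P_def subgraph_def)
  ultimately show ?thesis by blast
qed

lemma block_union_subgraph:
  assumes "A \<subseteq> blocks G"
  shows "edges (union_of_blocks A) \<subseteq> edges G" "verts (union_of_blocks A) \<subseteq> verts G"
  using assms block_nonsep_subgraph by (force simp: union_of_blocks_def subgraph_def)+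

text \<open>A set of blocks meeting \<open>B\<close> twice would provide an ear enlarging \<open>B\<close>.\<close>

lemma block_attach:
  assumes S: "S \<subseteq> blocks G" "connected_graph (union_of_blocks S)" and B: "B \<in> blocks G" "B \<notin> S"
    and v: "v \<in> verts B" "v \<in> \<Union>(verts ` S)" and w: "w \<in> verts B" "w \<in> \<Union>(verts ` S)"
  shows "v = w"
proof (rule ccontr)
  assume "v \<noteq> w"
  let ?F = "edges (union_of_blocks S)"
  have "(v, w) \<in> (adj ?F {})\<^sup>*"
    using S v w by (auto simp: connected_graph_iff union_of_blocks_def)
  then obtain K where K: "nonsep K" "subgraph K G" "subgraph B K" "edges K \<inter> ?F \<noteq> {}"
    using ear_exists[OF block_nonsep_subgraph[OF B(1)] G(1) block_union_subgraph(1)[OF S(1)] v(1) w(1)]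
      \<open>v \<noteq> w\<close> by blast
  then have "K = B" using block_maximal B by blast
  then obtain C e where C: "C \<in> S" "e \<in> edges C" "e \<in> edges B"
    using K by (auto simp: union_of_blocks_def)
  have BG: "nonsep B" "subgraph B G" and CG: "nonsep C" "subgraph C G" and Cb: "C \<in> blocks G"
    using block_nonsep_subgraph B C S by blast+
  have simple: "simple_graph B" "simple_graph C" using BG CG by (auto simp: subgraph_def)
  obtain a b where ab: "e = {a, b}" using simple C by (auto simp: simple_graph_def)
  \<comment> \<open>Maximality has made the ear part of \<open>B\<close>, so \<open>B\<close> shares
    an edge with a block \<open>C\<close> of \<open>S\<close>. The union of \<open>B\<close> and
    \<open>C\<close> then contradicts the maximality of both.\<close>
  let ?U = "(verts B \<union> verts C, edges B \<union> edges C)"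
  have "nonsep ?U"
    using simple_edge_verts[OF simple(1)] simple_edge_verts[OF simple(2)] C ab
      subgraph_finite[OF BG(2)] subgraph_finite[OF CG(2)]
    by (intro nonsep_union[OF BG(1) CG(1), of a b]) auto
  moreover have "simple_graph ?U" using simple by (fastforce simp: simple_graph_def)
  then have "subgraph ?U G" "subgraph B ?U" "subgraph C ?U"
    using BG CG by (auto simp: subgraph_def)
  ultimately have "?U = B" "?U = C" using block_maximal B(1) Cb by blast+
  then show False using B C by simp
qed

end

section \<open>Hypertrees\<close>

text \<open>Such a \<open>T\<close> is a union of connected components of the family
  \<open>S\<close>, where two members are adjacent if their vertex sets meet.\<close>

definition uncut :: "('b \<Rightarrow> 'v set) \<Rightarrow> 'b set \<Rightarrow> 'b set \<Rightarrow> bool" where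
  "uncut V T S \<longleftrightarrow> T \<subseteq> S \<and> (\<forall>B \<in> T. \<forall>C \<in> S - T. V B \<inter> V C = {})"

definition linked :: "('b \<Rightarrow> 'v set) \<Rightarrow> 'b set \<Rightarrow> bool" where
  "linked V S \<longleftrightarrow> (\<forall>T. uncut V T S \<longrightarrow> T = {} \<or> T = S)"

definition vdeg :: "('b \<Rightarrow> 'v set) \<Rightarrow> 'b set \<Rightarrow> 'v \<Rightarrow> nat" where
  "vdeg V A v = card {B \<in> A. v \<in> V B}"

text \<open>Truncated subtraction lets vertices outside the family contribute 0 rather than
  -1.\<close>

definition excess :: "('b \<Rightarrow> 'v::finite set) \<Rightarrow> 'b set \<Rightarrow> nat" where
  "excess V A = (\<Sum>v\<in>UNIV. vdeg V A v - 1)"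

definition coef :: "('b \<Rightarrow> 'v set) \<Rightarrow> ('v \<Rightarrow> 'b) \<Rightarrow> 'b \<Rightarrow> real" where
  "coef V f B = 1 - real (card {v \<in> V B. f v \<noteq> B})"

definition selector :: "('b \<Rightarrow> 'v set) \<Rightarrow> ('v \<Rightarrow> 'b) \<Rightarrow> 'b set \<Rightarrow> bool" where
  "selector V f C \<longleftrightarrow> (\<forall>B \<in> C. \<forall>v \<in> V B. f v \<in> C \<and> v \<in> V (f v))"

lemma linked_empty: "linked V {}"
  by (auto simp: linked_def uncut_def)

lemma linked_singleton: "linked V {B}"
  by (auto simp: linked_def uncut_def)

text \<open>An uncut set restricts to an uncut set on either side, so it contains all or nothing of
  \<open>C\<close> and of \<open>D\<close>; the meeting pair \<open>B\<close>, \<open>B'\<close>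
  couples the two choices.\<close>

lemma linked_Un:
  assumes "linked V C" "linked V D" "B \<in> C" "B' \<in> D" "V B \<inter> V B' \<noteq> {}"
  shows "linked V (C \<union> D)"
  unfolding linked_def
proof (intro allI impI)
  fix T assume T: "uncut V T (C \<union> D)"
  have "uncut V (T \<inter> C) C" "uncut V (T \<inter> D) D" using T by (auto simp: uncut_def)
  then have "T \<inter> C = {} \<or> T \<inter> C = C" "T \<inter> D = {} \<or> T \<inter> D = D"
    using assms(1,2) by (auto simp: linked_def)
  moreover have "B \<in> T \<longleftrightarrow> B' \<in> T"
    using T assms(3-5) by (fastforce simp: uncut_def)
  ultimately show "T = {} \<or> T = C \<union> D" using T assms(3,4) by (auto simp: uncut_def)
qed

lemma linked_insert:
  "linked V C \<Longrightarrow> B' \<in> C \<Longrightarrow> V B \<inter> V B' \<noteq> {} \<Longrightarrow> linked V (insert B C)"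
  using linked_Un[OF linked_singleton[of V B], of C B B'] by simp

lemma linked_neighbour:
  assumes "linked V S" "T \<subseteq> S" "T \<noteq> {}" "T \<noteq> S"
  obtains B C where "B \<in> T" "C \<in> S - T" "V B \<inter> V C \<noteq> {}"
proof -
  have "\<not> uncut V T S" using assms by (auto simp: linked_def)
  then show ?thesis using assms(2) that by (auto simp: uncut_def)
qed

text \<open>A smallest nonempty uncut set works, because an uncut subset of an uncut set is again
  uncut in \<open>S\<close>.\<close>

lemma linked_component:
  assumes "finite S" "S \<noteq> {}"
  obtains T where "uncut V T S" "T \<noteq> {}" "linked V T"
proof -
  have "\<exists>T. uncut V T S \<and> T \<noteq> {}" using assms by (auto simp: uncut_def)
  then obtain T where T: "uncut V T S \<and> T \<noteq> {}"
      and min: "\<And>T'. uncut V T' S \<and> T' \<noteq> {} \<Longrightarrow> card T \<le> card T'"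
    using ex_has_least_nat[of "\<lambda>T. uncut V T S \<and> T \<noteq> {}" _ card] by blast
  have "linked V T"
    unfolding linked_def
  proof (intro allI impI)
    fix T' assume T': "uncut V T' T"
    have "finite T" using T assms(1) by (auto simp: uncut_def intro: finite_subset)
    show "T' = {} \<or> T' = T"
    proof (rule disjCI)
      assume "T' \<noteq> T"
      then have "T' \<subset> T" using T' by (auto simp: uncut_def)
      then have "card T' < card T" using \<open>finite T\<close> by (rule psubset_card_mono[rotated])
      moreover have "uncut V T' S" using T T' unfolding uncut_def by blast
      ultimately show "T' = {}" using min by (meson not_le)
    qed
  qed
  then show ?thesis using T that by blast
qed

lemma vdeg_eq_0: "finite A \<Longrightarrow> vdeg V A v = 0 \<longleftrightarrow> (\<forall>B \<in> A. v \<notin> V B)"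
  by (auto simp: vdeg_def)

lemma vdeg_Un_Int:
  assumes "finite C" "finite D"
  shows "vdeg V C v + vdeg V D v = vdeg V (C \<union> D) v + vdeg V (C \<inter> D) v"
proof -
  have "{B \<in> C \<union> D. v \<in> V B} = {B \<in> C. v \<in> V B} \<union> {B \<in> D. v \<in> V B}"
    "{B \<in> C \<inter> D. v \<in> V B} = {B \<in> C. v \<in> V B} \<inter> {B \<in> D. v \<in> V B}" by auto
  then show ?thesis
    unfolding vdeg_def by (simp only:) (rule card_Un_Int, use assms in auto)
qed

lemma vdeg_mono: "finite D \<Longrightarrow> C \<subseteq> D \<Longrightarrow> vdeg V C v \<le> vdeg V D v"
  unfolding vdeg_def by (intro card_mono) auto

text \<open>Degrees are modular in the set of blocks, and truncated subtraction of 1 is a convex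
  function of the degree.\<close>

lemma excess_supermodular:
  assumes "finite C" "finite D"
  shows "excess V C + excess V D \<le> excess V (C \<union> D) + excess V (C \<inter> D)"
  unfolding excess_def sum.distrib[symmetric]
proof (rule sum_mono)
  fix v
  have "vdeg V (C \<inter> D) v \<le> vdeg V C v" "vdeg V (C \<inter> D) v \<le> vdeg V D v"
    using assms by (auto intro: vdeg_mono)
  then show "vdeg V C v - 1 + (vdeg V D v - 1) \<le> vdeg V (C \<union> D) v - 1 + (vdeg V (C \<inter> D) v - 1)"
    using vdeg_Un_Int[OF assms, of V v] by linarith
qed

lemma excess_disjoint:
  assumes "finite S" "uncut V T S"
  shows "excess V S = excess V T + excess V (S - T)"
proof -
  have "vdeg V S v - 1 = (vdeg V T v - 1) + (vdeg V (S - T) v - 1)" for v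
  proof -
    have fin: "finite T" "finite (S - T)" and TS: "T \<union> (S - T) = S"
      using assms by (auto simp: uncut_def intro: finite_subset)
    have "vdeg V T v = 0 \<or> vdeg V (S - T) v = 0"
      using fin assms(2) by (auto simp: vdeg_eq_0 uncut_def)
    moreover have "vdeg V S v = vdeg V T v + vdeg V (S - T) v"
      using vdeg_Un_Int[OF fin, of V v] unfolding TS by (simp add: vdeg_def)
    ultimately show ?thesis by auto
  qed
  then show ?thesis by (simp add: excess_def sum.distrib)
qed

lemma finite_maximal_card:
  fixes P :: "'b::finite set \<Rightarrow> bool"
  assumes "P S0"
  obtains S where "P S" "\<And>T. P T \<Longrightarrow> card T \<le> card S"
proof -
  have "\<forall>S. P S \<longrightarrow> card S < Suc (card (UNIV :: 'b set))" by (simp add: card_mono less_Suc_eq_le)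
  with assms have "\<exists>S. P S \<and> (\<forall>T. P T \<longrightarrow> card T \<le> card S)" by (rule ex_has_greatest_nat)
  then show ?thesis using that by blast
qed

section \<open>Hypertrees and their counting formula\<close>

text \<open>An abstraction of the blocks of a connected graph with their vertex sets:
  \<open>attach\<close> expresses acyclicity and \<open>linked_all\<close> connectedness.\<close>

locale hypertree =
  fixes Bs :: "'b::finite set" and V :: "'b \<Rightarrow> 'v::finite set"
  assumes nonempty: "B \<in> Bs \<Longrightarrow> V B \<noteq> {}"
    and attach: "S \<subseteq> Bs \<Longrightarrow> linked V S \<Longrightarrow> B \<in> Bs \<Longrightarrow> B \<notin> S \<Longrightarrow>
      v \<in> V B \<Longrightarrow> v \<in> \<Union>(V ` S) \<Longrightarrow> w \<in> V B \<Longrightarrow> w \<in> \<Union>(V ` S) \<Longrightarrow> v = w"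
    and linked_all: "linked V Bs"
begin

text \<open>By \<open>attach\<close> the new block meets the old ones only in \<open>w\<close>. Its
  other vertices rise from degree 0 to 1, which adds no excess.\<close>

lemma excess_insert:
  assumes "S \<subseteq> Bs" "linked V S" "B \<in> Bs" "B \<notin> S" "w \<in> V B" "w \<in> \<Union>(V ` S)"
  shows "excess V (insert B S) = Suc (excess V S)"
proof -
  have "vdeg V (insert B S) v - 1 = (vdeg V S v - 1) + (if v = w then 1 else 0)" for v
  proof -
    have ins: "vdeg V (insert B S) v = (if v \<in> V B then 1 else 0) + vdeg V S v"
    proof -
      have "{C \<in> insert B S. v \<in> V C} = (if v \<in> V B then insert B {C \<in> S. v \<in> V C} else {C \<in> S. v \<in> V C})"
        by auto
      then show ?thesis using assms(4) by (auto simp: vdeg_def)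
    qed
    consider "v = w" | "v \<noteq> w" "v \<in> V B" "vdeg V S v = 0" | "v \<notin> V B"
      using attach[OF assms(1-4) _ _ assms(5,6), of v] by (auto simp: vdeg_eq_0)
    then show ?thesis
    proof cases
      case 1
      then have "vdeg V S v \<noteq> 0" using assms(6) by (auto simp: vdeg_eq_0)
      then show ?thesis using 1 ins assms(5) by auto
    qed (use ins assms(5) in auto)
  qed
  then show ?thesis by (simp add: excess_def sum.distrib)
qed

text \<open>A linked set can be built up from one block, each further block adding 1 on both sides;
  a largest subset satisfying the formula must therefore be all of \<open>C\<close>.\<close>

lemma card_linked:
  assumes C: "C \<subseteq> Bs" "linked V C" "C \<noteq> {}"
  shows "card C = Suc (excess V C)"
proof -
  define P where "P S \<longleftrightarrow> S \<subseteq> C \<and> S \<noteq> {} \<and> linked V S \<and> card S = Suc (excess V S)" for S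
  obtain B where "B \<in> C" using C by blast
  have "vdeg V {B} v - 1 = 0" for v using card_mono[of "{B}" "{C \<in> {B}. v \<in> V C}"] by (auto simp: vdeg_def)
  then have "P {B}" using \<open>B \<in> C\<close> linked_singleton[of V B] by (simp add: P_def excess_def)
  then obtain S where S: "P S" "\<And>T. P T \<Longrightarrow> card T \<le> card S"
    using finite_maximal_card by metis
  have "S = C"
  proof (rule ccontr)
    assume "S \<noteq> C"
    moreover have "S \<subseteq> C" "S \<noteq> {}" using S(1) by (simp_all add: P_def)
    ultimately obtain B D where BD: "B \<in> S" "D \<in> C - S" "V B \<inter> V D \<noteq> {}"
      using linked_neighbour[OF C(2), of S] by metis
    then obtain w where w: "w \<in> V B" "w \<in> V D" by blast
    have "excess V (insert D S) = Suc (excess V S)"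
      using S(1) BD w C(1) by (intro excess_insert[of _ _ w]) (auto simp: P_def)
    moreover have "linked V (insert D S)"
      using S(1) BD by (intro linked_insert[of V S B D]) (auto simp: P_def)
    ultimately have "P (insert D S)" using S(1) BD by (auto simp: P_def)
    then show False using S(2) BD by fastforce
  qed
  then show ?thesis using S(1) by (simp add: P_def)
qed

text \<open>Splitting off components, each of them contributes at least one to the difference
  between cardinality and excess. Difference exactly one thus characterizes linked sets.\<close>

lemma excess_less_card:
  assumes "C \<subseteq> Bs" "C \<noteq> {}"
  shows "card C \<ge> Suc (excess V C) \<and> (card C = Suc (excess V C) \<longrightarrow> linked V C)"
  using assms
proof (induction "card C" arbitrary: C rule: less_induct)
  case less
  show ?case
  proof (cases "linked V C")
    case True
    then show ?thesis using card_linked less.prems by auto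
  next
    case False
    then obtain T where T: "uncut V T C" "T \<noteq> {}" "T \<noteq> C" by (auto simp: linked_def)
    then have TC: "T \<subset> C" "C - T \<subset> C" by (auto simp: uncut_def)
    have "card T \<ge> Suc (excess V T)"
      using less.hyps[of T] TC T less.prems psubset_card_mono[OF _ TC(1)] by auto
    moreover have "card (C - T) \<ge> Suc (excess V (C - T))"
      using less.hyps[of "C - T"] TC T less.prems psubset_card_mono[OF _ TC(2)] by auto
    moreover have "card C = card T + card (C - T)"
      using TC card_mono[of C T] by (auto simp: card_Diff_subset)
    ultimately show ?thesis using excess_disjoint[OF _ T(1)] by simp
  qed
qed

text \<open>With the counting formula for \<open>C\<close>, \<open>D\<close> and their union,
  supermodularity bounds the cardinality of the intersection so tightly that it must be
  linked.\<close>

lemma linked_Int: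
  assumes "C \<subseteq> Bs" "D \<subseteq> Bs" "linked V C" "linked V D"
  shows "linked V (C \<inter> D)"
proof (cases "C \<inter> D = {}")
  case True
  then show ?thesis by (simp add: linked_empty)
next
  case False
  then obtain B where B: "B \<in> C" "B \<in> D" by blast
  then have "linked V (C \<union> D)" using linked_Un[OF assms(3,4) B] nonempty assms(1) by blast
  then have "card (C \<union> D) = Suc (excess V (C \<union> D))"
    using card_linked[of "C \<union> D"] assms B by blast
  moreover have "card C = Suc (excess V C)" "card D = Suc (excess V D)"
    using card_linked assms B by blast+
  moreover have "card C + card D = card (C \<union> D) + card (C \<inter> D)" by (rule card_Un_Int) auto
  ultimately have "card (C \<inter> D) \<le> Suc (excess V (C \<inter> D))"
    using excess_supermodular[of C D V] by simp
  then show ?thesis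
    using excess_less_card[of "C \<inter> D"] False assms(1) by (meson antisym le_infI1)
qed

text \<open>Double counting of the pairs of a block and one of its vertices that selects another
  block.\<close>

lemma sum_coef:
  "(\<Sum>B\<in>C. coef V f B) = real (card C) - (\<Sum>v\<in>UNIV. real (card {B \<in> C. v \<in> V B \<and> f v \<noteq> B}))"
proof -
  have "(\<Sum>B\<in>C. card {v \<in> V B. f v \<noteq> B}) = (\<Sum>B\<in>C. card {v \<in> UNIV. v \<in> V B \<and> f v \<noteq> B})"
    by simp
  also have "\<dots> = (\<Sum>v\<in>UNIV. card {B \<in> C. v \<in> V B \<and> f v \<noteq> B})"
    by (rule sum_multicount_gen) auto
  finally show ?thesis
    unfolding coef_def sum_subtractf by (simp flip: of_nat_sum)
qed

text \<open>At each vertex at most one incident block is the selected one. Summed over the vertices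
  this compares the count in \<open>sum_coef\<close> with the excess.\<close>

lemma card_not_selected:
  "vdeg V C v - 1 \<le> card {B \<in> C. v \<in> V B \<and> f v \<noteq> B}"
  "f v \<in> C \<Longrightarrow> v \<in> V (f v) \<Longrightarrow> card {B \<in> C. v \<in> V B \<and> f v \<noteq> B} = vdeg V C v - 1"
proof -
  have eq: "{B \<in> C. v \<in> V B \<and> f v \<noteq> B} = {B \<in> C. v \<in> V B} - {f v}" by auto
  show "vdeg V C v - 1 \<le> card {B \<in> C. v \<in> V B \<and> f v \<noteq> B}"
    using diff_card_le_card_Diff[of "{f v}" "{B \<in> C. v \<in> V B}"] unfolding eq vdeg_def by simp
  show "card {B \<in> C. v \<in> V B \<and> f v \<noteq> B} = vdeg V C v - 1" if "f v \<in> C" "v \<in> V (f v)"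
    unfolding eq vdeg_def using that by (subst card_Diff_singleton) auto
qed

lemma sum_coef_le:
  assumes "C \<subseteq> Bs" "linked V C" "C \<noteq> {}"
  shows "(\<Sum>B\<in>C. coef V f B) \<le> 1"
proof -
  have "excess V C \<le> (\<Sum>v\<in>UNIV. card {B \<in> C. v \<in> V B \<and> f v \<noteq> B})"
    unfolding excess_def by (intro sum_mono card_not_selected)
  then have "real (excess V C) \<le> (\<Sum>v\<in>UNIV. real (card {B \<in> C. v \<in> V B \<and> f v \<noteq> B}))"
    by (simp flip: of_nat_sum)
  then show ?thesis using card_linked[OF assms] by (simp add: sum_coef)
qed

lemma sum_coef_selector:
  assumes "C \<subseteq> Bs" "linked V C" "C \<noteq> {}" "selector V f C"
  shows "(\<Sum>B\<in>C. coef V f B) = 1"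
proof -
  have "card {B \<in> C. v \<in> V B \<and> f v \<noteq> B} = vdeg V C v - 1" for v
  proof (cases "\<exists>B \<in> C. v \<in> V B")
    case True
    then show ?thesis using assms(4) card_not_selected(2) by (auto simp: selector_def)
  next
    case False
    then have "{B \<in> C. v \<in> V B \<and> f v \<noteq> B} = {}" "{B \<in> C. v \<in> V B} = {}" by blast+
    then show ?thesis unfolding vdeg_def by (metis card.empty diff_0_eq_0)
  qed
  then have "(\<Sum>v\<in>UNIV. real (card {B \<in> C. v \<in> V B \<and> f v \<noteq> B})) = real (excess V C)"
    by (simp add: excess_def)
  then show ?thesis using card_linked[OF assms(1-3)] by (simp add: sum_coef)
qed

end

section \<open>The digraph of a selector\<close>

definition sel_step :: "('b \<Rightarrow> 'v set) \<Rightarrow> ('v \<Rightarrow> 'b) \<Rightarrow> ('b \<times> 'b) set" where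
  "sel_step V f = {(B, f v) | B v. v \<in> V B}"

text \<open>Within a set closed under \<open>f\<close>, this is the smallest closed subset
  containing \<open>B\<close>.\<close>

definition sel_reach :: "('b \<Rightarrow> 'v set) \<Rightarrow> ('v \<Rightarrow> 'b) \<Rightarrow> 'b \<Rightarrow> 'b set" where
  "sel_reach V f B = (sel_step V f)\<^sup>* `` {B}"

lemma sel_reach_self: "B \<in> sel_reach V f B"
  by (auto simp: sel_reach_def)

lemma sel_reach_trans: "B' \<in> sel_reach V f B \<Longrightarrow> sel_reach V f B' \<subseteq> sel_reach V f B"
  by (auto simp: sel_reach_def)

lemma sel_reach_step: "B' \<in> sel_reach V f B \<Longrightarrow> v \<in> V B' \<Longrightarrow> f v \<in> sel_reach V f B"
  by (auto simp: sel_reach_def sel_step_def intro: rtrancl_into_rtrancl)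

lemma sel_reach_subset:
  assumes "selector V f C" "B \<in> C"
  shows "sel_reach V f B \<subseteq> C"
proof
  fix D assume "D \<in> sel_reach V f B"
  then have "(B, D) \<in> (sel_step V f)\<^sup>*" by (simp add: sel_reach_def)
  then show "D \<in> C"
    by (induction rule: rtrancl_induct) (use assms in \<open>auto simp: selector_def sel_step_def\<close>)
qed

lemma selector_sel_reach:
  assumes "selector V f C" "B \<in> C"
  shows "selector V f (sel_reach V f B)"
  using sel_reach_subset[OF assms] assms(1) sel_reach_step by (fastforce simp: selector_def)

text \<open>The two blocks of an arc share the selecting vertex, so an uncut set contains both or
  neither.\<close>

lemma linked_sel_reach:
  assumes "selector V f C" "B \<in> C"
  shows "linked V (sel_reach V f B)"
  unfolding linked_def
proof (intro allI impI)
  fix T assume T: "uncut V T (sel_reach V f B)"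
  have same: "D \<in> T \<longleftrightarrow> B \<in> T" if "D \<in> sel_reach V f B" for D
  proof -
    have "(B, D) \<in> (sel_step V f)\<^sup>*" using that by (simp add: sel_reach_def)
    then show ?thesis
    proof (induction rule: rtrancl_induct)
      case base
      then show ?case by simp
    next
      case (step D E)
      then obtain v where v: "v \<in> V D" "E = f v" by (auto simp: sel_step_def)
      have D: "D \<in> sel_reach V f B" using step by (auto simp: sel_reach_def)
      then have E: "E \<in> sel_reach V f B" using v sel_reach_step by fast
      have "v \<in> V E" using v D sel_reach_subset[OF assms] assms(1) by (auto simp: selector_def)
      then have "V D \<inter> V E \<noteq> {}" "V E \<inter> V D \<noteq> {}" using v by auto
      then have "E \<in> T \<longleftrightarrow> D \<in> T" using T D E unfolding uncut_def by blast
      then show ?case using step.IH by simp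
    qed
  qed
  show "T = {} \<or> T = sel_reach V f B"
    using same T unfolding uncut_def by blast
qed

context hypertree
begin

text \<open>
  A strongly connected set \<open>K\<close> of at least two blocks would contain, for each of its blocks, a vertex
  selecting another one; these are at least \<open>card K\<close> incidences, but only \<open>card K - 1\<close> are available.
\<close>

lemma sel_reach_antisym:
  assumes C: "C \<subseteq> Bs" "selector V f C" "B \<in> C" and BD: "D \<in> sel_reach V f B" "B \<in> sel_reach V f D"
  shows "B = D"
proof (rule ccontr)
  assume "B \<noteq> D"
  \<comment> \<open>The strongly connected component of \<open>B\<close>.\<close>
  define K where "K = {E \<in> sel_reach V f B. B \<in> sel_reach V f E}"
  have "D \<in> C" using sel_reach_subset[OF C(2,3)] BD by auto
  have KC: "K \<subseteq> C" using sel_reach_subset[OF C(2,3)] by (auto simp: K_def)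
  have BK: "B \<in> K" by (simp add: K_def sel_reach_self)
  have out: "\<exists>v \<in> V E. f v \<noteq> E \<and> f v \<in> K \<and> v \<in> V (f v)" if E: "E \<in> K" for E
  proof -
    obtain E' where E': "E' \<in> K" "E' \<noteq> E" "E' \<in> sel_reach V f E"
    proof (cases "E = B")
      case True
      then show ?thesis using that[of D] BD \<open>B \<noteq> D\<close> by (auto simp: K_def)
    next
      case False
      then show ?thesis using that[of B] E BK by (auto simp: K_def)
    qed
    then have "(E, E') \<in> (sel_step V f)\<^sup>*" by (simp add: sel_reach_def)
    \<comment> \<open>A block may select itself; without these loops the first arc of a walk really
      leaves \<open>E\<close>.\<close>
    then have "(E, E') \<in> (sel_step V f - Id)\<^sup>*" by (simp only: rtrancl_r_diff_Id)
    then obtain F where F: "(E, F) \<in> sel_step V f" "F \<noteq> E" "(F, E') \<in> (sel_step V f - Id)\<^sup>*"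
      using E'(2) by (metis DiffD1 DiffD2 IdI converse_rtranclE)
    have FE': "E' \<in> sel_reach V f F" using F(3) by (simp only: rtrancl_r_diff_Id sel_reach_def) simp
    have FE: "F \<in> sel_reach V f E" using F(1) by (auto simp: sel_reach_def)
    have "F \<in> K"
      using FE FE' E E'(1) sel_reach_trans[of E V f B] sel_reach_trans[of E' V f F]
      by (auto simp: K_def)
    moreover obtain v where v: "v \<in> V E" "F = f v" using F(1) by (auto simp: sel_step_def)
    moreover have "v \<in> V (f v)" using v E KC C(2) by (auto simp: selector_def)
    ultimately show ?thesis using F(2) by auto
  qed
  have linkK: "linked V K"
    unfolding linked_def
  proof (intro allI impI)
    fix T assume T: "uncut V T K"
    have same: "E \<in> T \<longleftrightarrow> B \<in> T" if "E \<in> K" for E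
    proof -
      have "(B, E) \<in> (sel_step V f)\<^sup>*" "E \<in> K" using that by (simp_all add: sel_reach_def K_def)
      then show ?thesis
      proof (induction rule: rtrancl_induct)
        case base
        then show ?case by simp
      next
        case (step E F)
        then obtain v where v: "v \<in> V E" "F = f v" by (auto simp: sel_step_def)
        have "E \<in> sel_reach V f B" "F \<in> sel_reach V f E"
          using step by (auto simp: sel_reach_def)
        then have "E \<in> K" using step.prems sel_reach_trans[of F V f E] by (auto simp: K_def)
        moreover from this have "v \<in> V F" using v KC C(2) by (auto simp: selector_def)
        then have "V E \<inter> V F \<noteq> {}" "V F \<inter> V E \<noteq> {}" using v by auto
        ultimately have "F \<in> T \<longleftrightarrow> E \<in> T" using T step.prems unfolding uncut_def by blast
        then show ?case using step.IH \<open>E \<in> K\<close> by simp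
      qed
    qed
    show "T = {} \<or> T = K" using same T unfolding uncut_def by blast
  qed
  have "card K = Suc (excess V K)" using card_linked[of K] linkK KC C(1) BK by blast
  moreover have "card K \<le> excess V K"
  proof -
    define J where "J E = {v \<in> UNIV. v \<in> V E \<and> f v \<noteq> E \<and> f v \<in> K \<and> v \<in> V (f v)}" for E
    have "card K = (\<Sum>E\<in>K. 1)" by simp
    also have "\<dots> \<le> (\<Sum>E\<in>K. card (J E))"
    proof (rule sum_mono)
      fix E assume "E \<in> K"
      then have "J E \<noteq> {}" using out by (auto simp: J_def)
      then show "1 \<le> card (J E)" by (simp add: Suc_le_eq card_gt_0_iff)
    qed
    also have "\<dots> = (\<Sum>v\<in>UNIV. card {E \<in> K. v \<in> V E \<and> f v \<noteq> E \<and> f v \<in> K \<and> v \<in> V (f v)})"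
      unfolding J_def by (rule sum_multicount_gen) auto
    also have "\<dots> \<le> excess V K"
      unfolding excess_def
    proof (rule sum_mono)
      fix v
      show "card {E \<in> K. v \<in> V E \<and> f v \<noteq> E \<and> f v \<in> K \<and> v \<in> V (f v)} \<le> vdeg V K v - 1"
      \<comment> \<open>Of the blocks of \<open>K\<close> at \<open>v\<close>, the selected one is
        not counted, which leaves at most the degree minus one.\<close>
      proof (cases "f v \<in> K \<and> v \<in> V (f v)")
        case True
        then show ?thesis using card_not_selected(2)[of f v K] by simp
      next
        case False
        then have "{E \<in> K. v \<in> V E \<and> f v \<noteq> E \<and> f v \<in> K \<and> v \<in> V (f v)} = {}" by blast
        then show ?thesis by (simp only: card.empty)
      qed
    qed
    finally show ?thesis .
  qed
  ultimately show False by simp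
qed

section \<open>Integral functions of total one\<close>

text \<open>A largest proper linked subset misses just one block, for otherwise a neighbouring block
  could be added to it.\<close>

lemma leaf:
  assumes C: "C \<subseteq> Bs" "linked V C" "card C \<ge> 2"
  obtains L w where "L \<in> C" "linked V (C - {L})" "C - {L} \<noteq> {}" "w \<in> V L" "w \<in> \<Union>(V ` (C - {L}))"
    "\<And>v. v \<in> V L \<Longrightarrow> v \<in> \<Union>(V ` (C - {L})) \<Longrightarrow> v = w"
proof -
  define P where "P S \<longleftrightarrow> S \<subset> C \<and> S \<noteq> {} \<and> linked V S" for S
  obtain B where "B \<in> C" using C by fastforce
  have "P {B}" using \<open>B \<in> C\<close> linked_singleton[of V B] C(3) by (auto simp: P_def)
  then obtain S where S: "P S" "\<And>T. P T \<Longrightarrow> card T \<le> card S"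
    using finite_maximal_card by metis
  obtain D L where DL: "D \<in> S" "L \<in> C - S" "V D \<inter> V L \<noteq> {}"
    using linked_neighbour[OF C(2), of S] S(1) unfolding P_def by (metis psubset_eq)
  have "linked V (insert L S)"
    using S(1) DL by (intro linked_insert[of V S D L]) (auto simp: P_def)
  then have "\<not> insert L S \<subset> C" using S(2)[of "insert L S"] DL by (auto simp: P_def)
  then have CL: "C - {L} = S" using S(1) DL by (auto simp: P_def)
  obtain w where w: "w \<in> V D" "w \<in> V L" using DL by blast
  show ?thesis
  proof (rule that[of L w])
    show "v = w" if "v \<in> V L" "v \<in> \<Union>(V ` (C - {L}))" for v
      using attach[of S L v w] that S(1) DL C(1) w unfolding CL by (auto simp: P_def)
  qed (use S(1) DL w in \<open>auto simp: CL P_def\<close>)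
qed

text \<open>Induction on a leaf \<open>L\<close> attached at \<open>w\<close>, whose value turns out
  to be 0 or 1. In the first case \<open>L\<close> is selected by its private vertices only, in the
  second by \<open>w\<close> as well.\<close>

lemma integral_eq_coef:
  fixes a :: "'b \<Rightarrow> real"
  assumes "C \<subseteq> Bs" "linked V C" "C \<noteq> {}" "\<And>B. B \<in> C \<Longrightarrow> a B \<in> \<int>" "sum a C = 1"
    and "\<And>D. D \<subseteq> C \<Longrightarrow> linked V D \<Longrightarrow> D \<noteq> {} \<Longrightarrow> sum a D \<le> 1"
  shows "\<exists>f. selector V f C \<and> (\<forall>B \<in> C. a B = coef V f B)"
  using assms
proof (induction "card C" arbitrary: C a rule: less_induct)
  case less
  show ?case
  proof (cases "card C \<ge> 2")
    case False
    then have "card C = 1" using less.prems(3) by (simp add: card_gt_0_iff order_antisym Suc_le_eq not_le)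
    then obtain B where "C = {B}" by (auto simp: card_1_singleton_iff)
    then show ?thesis using less.prems(5)
      by (intro exI[of _ "\<lambda>_. B"]) (auto simp: selector_def coef_def)
  next
    case True
    obtain L w where L: "L \<in> C" "linked V (C - {L})" "C - {L} \<noteq> {}" "w \<in> V L" "w \<in> \<Union>(V ` (C - {L}))"
      and uniq: "\<And>v. v \<in> V L \<Longrightarrow> v \<in> \<Union>(V ` (C - {L})) \<Longrightarrow> v = w"
      using leaf[OF less.prems(1,2) True] by metis
    define C' where "C' = C - {L}"
    have C': "C' \<subseteq> Bs" "linked V C'" "C' \<noteq> {}" "card C' < card C" "L \<notin> C'"
      using L less.prems(1) card_Diff1_less[of C L] by (auto simp: C'_def)
    have uniq': "v = w" if "v \<in> V L" "v \<in> V B" "B \<in> C'" for v B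
      using uniq that by (auto simp: C'_def)
    have split: "a L + sum a C' = 1"
      using less.prems(5) L(1) by (simp add: C'_def sum.remove)
    have add_L: "a L + sum a D \<le> 1" if D: "D \<subseteq> C'" "linked V D" "B \<in> D" "w \<in> V B" for D B
    proof -
      have "linked V (insert L D)" using D L(4) by (intro linked_insert[of V D B L]) auto
      then have "sum a (insert L D) \<le> 1" using D L(1) by (intro less.prems(6)) (auto simp: C'_def)
      moreover have "L \<notin> D" using D(1) C'(5) by auto
      ultimately show ?thesis by simp
    qed
    \<comment> \<open>Integrality enters here: the singleton bounds \<open>a L\<close> from above,
      the bound on the complement together with the total bounds it from below.\<close>
    have "a L \<in> \<int>" using less.prems(4) L(1) by blast
    moreover have "a L \<le> 1" using less.prems(6)[of "{L}"] L(1) linked_singleton[of V L] by auto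
    moreover have "a L \<ge> 0" using less.prems(6)[of C'] C' split by (auto simp: C'_def)
    ultimately have "a L = 0 \<or> a L = 1" by (auto elim!: Ints_cases)
    then consider "a L = 0" | "a L = 1" by blast
    then show ?thesis
    proof cases
      case 1
      have "\<exists>f. selector V f C' \<and> (\<forall>B \<in> C'. a B = coef V f B)"
      proof (rule less.hyps)
        show "sum a D \<le> 1" if "D \<subseteq> C'" "linked V D" "D \<noteq> {}" for D
          using less.prems(6)[of D] that by (simp add: C'_def subset_Diff_insert)
        show "a B \<in> \<int>" if "B \<in> C'" for B using that less.prems(4) by (simp add: C'_def)
      qed (use C' split 1 in auto)
      then obtain f where f: "selector V f C'" "\<And>B. B \<in> C' \<Longrightarrow> a B = coef V f B" by blast
      define g where "g v = (if v \<in> V L \<and> v \<noteq> w then L else f v)" for v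
      have gf: "g v = f v" if "v \<in> V B" "B \<in> C'" for v B using uniq'[OF _ that] by (auto simp: g_def)
      have gw: "g w \<in> C'" "w \<in> V (g w)"
        using L(5) f(1) by (auto simp: g_def selector_def C'_def)
      have "selector V g C"
        unfolding selector_def
      proof (intro ballI)
        fix B v assume B: "B \<in> C" "v \<in> V B"
        show "g v \<in> C \<and> v \<in> V (g v)"
        proof (cases "B = L")
          case True
          then show ?thesis using B gw L(1) by (cases "v = w") (auto simp: C'_def g_def)
        next
          case False
          then have "B \<in> C'" using B by (simp add: C'_def)
          then have "f v \<in> C'" "v \<in> V (f v)" using f(1) B by (auto simp: selector_def)
          then show ?thesis using gf[of v B] B \<open>B \<in> C'\<close> by (auto simp: C'_def)
        qed
      qed
      moreover have "a B = coef V g B" if "B \<in> C" for B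
      proof (cases "B = L")
        case True
        have "{v \<in> V L. g v \<noteq> L} = {w}" using L(4) gw C'(5) by (auto simp: g_def)
        then show ?thesis using True 1 by (simp add: coef_def)
      next
        case False
        then have "B \<in> C'" using that by (simp add: C'_def)
        then have "{v \<in> V B. g v \<noteq> B} = {v \<in> V B. f v \<noteq> B}" using gf by (intro Collect_cong) metis
        then show ?thesis using f(2)[OF \<open>B \<in> C'\<close>] by (simp add: coef_def)
      qed
      ultimately show ?thesis by blast
    next
      case 2
      obtain B' where B': "B' \<in> C'" "w \<in> V B'" using L(5) by (auto simp: C'_def)
      \<comment> \<open>Taking \<open>w\<close> away from a block lowers its coefficient by 1. The
        function \<open>b\<close> undoes this loss at an arbitrary block \<open>B'\<close> at
        \<open>w\<close>, which also restores the total 1 on \<open>C'\<close>.\<close>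
      define b where "b = a(B' := a B' + 1)"
      have sum_b: "sum b D = sum a D + (if B' \<in> D then 1 else 0)" for D
      proof (cases "B' \<in> D")
        case True
        then show ?thesis by (simp add: b_def sum.remove[of D B'])
      next
        case False
        then have "sum b D = sum a D" by (intro sum.cong) (auto simp: b_def)
        then show ?thesis using False by simp
      qed
      have "\<exists>f. selector V f C' \<and> (\<forall>B \<in> C'. b B = coef V f B)"
      proof (rule less.hyps)
        show "sum b C' = 1" using split 2 B' by (simp add: sum_b)
        show "sum b D \<le> 1" if "D \<subseteq> C'" "linked V D" "D \<noteq> {}" for D
        proof (cases "B' \<in> D")
          case True
          then show ?thesis using add_L[of D B'] that B' 2 by (simp add: sum_b)
        next
          case False
          then show ?thesis using less.prems(6)[of D] that by (simp add: sum_b C'_def subset_Diff_insert)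
        qed
        show "b B \<in> \<int>" if "B \<in> C'" for B using that less.prems(4) by (auto simp: b_def C'_def)
      qed (use C' in auto)
      then obtain f where f: "selector V f C'" "\<And>B. B \<in> C' \<Longrightarrow> b B = coef V f B" by blast
      have fw: "f w \<in> C'" "w \<in> V (f w)" using f(1) B' by (auto simp: selector_def)
      \<comment> \<open>The closed set generated by \<open>f w\<close> has sum 1 under
        \<open>b\<close>, but at most 0 under \<open>a\<close> since \<open>L\<close> can be
        attached to it. So it contains \<open>B'\<close>; conversely \<open>B'\<close> reaches
        \<open>f w\<close> through \<open>w\<close>, and acyclicity identifies the two.\<close>
      have "f w = B'"
      proof (rule sel_reach_antisym[OF C'(1) f(1) fw(1)])
        let ?R = "sel_reach V f (f w)"
        have R: "?R \<subseteq> C'" "linked V ?R" "selector V f ?R" "f w \<in> ?R"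
          using sel_reach_subset linked_sel_reach selector_sel_reach sel_reach_self f(1) fw(1) by metis+
        have "sum (coef V f) ?R = 1"
          using R C'(1) by (intro sum_coef_selector) auto
        then have "sum b ?R = 1" using f(2) R(1) by (metis (no_types, lifting) subsetD sum.cong)
        moreover have "a L + sum a ?R \<le> 1" using R fw by (intro add_L[of _ "f w"]) auto
        ultimately show "B' \<in> ?R" using 2 by (simp add: sum_b split: if_splits)
        show "f w \<in> sel_reach V f B'" using B'(2) sel_reach_self[of B' V f] sel_reach_step by metis
      qed
      \<comment> \<open>The leaf takes over \<open>w\<close>, so that \<open>B'\<close> loses
        exactly this one selection.\<close>
      define g where "g v = (if v \<in> V L then L else f v)" for v
      have gf: "g v = f v" if "v \<in> V B" "B \<in> C'" "v \<noteq> w" for v B using uniq'[OF _ that(1,2)] that by (auto simp: g_def)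
      have gw: "g w = L" using L(4) by (simp add: g_def)
      have "selector V g C"
        unfolding selector_def
      proof (intro ballI)
        fix B v assume B: "B \<in> C" "v \<in> V B"
        show "g v \<in> C \<and> v \<in> V (g v)"
        proof (cases "v \<in> V L")
          case True
          then show ?thesis using L(1) by (auto simp: g_def)
        next
          case False
          then have "B \<in> C'" using B by (auto simp: C'_def)
          then have "f v \<in> C'" "v \<in> V (f v)" using f(1) B by (auto simp: selector_def)
          then show ?thesis using False by (auto simp: C'_def g_def)
        qed
      qed
      moreover have "a B = coef V g B" if BC: "B \<in> C" for B
      proof -
        consider "B = L" | "B = B'" | "B \<in> C'" "B \<noteq> B'"
          using BC by (auto simp: C'_def)
        then show ?thesis
        proof cases
          case 1
          then have "{v \<in> V B. g v \<noteq> B} = {}" by (auto simp: g_def)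
          then show ?thesis using 1 2 by (simp add: coef_def)
        next
          case 2
          have "g w \<noteq> B'" "f w = B'" using gw C'(5) B' \<open>f w = B'\<close> by auto
          then have "v \<in> {v \<in> V B'. g v \<noteq> B'} \<longleftrightarrow> v \<in> insert w {v \<in> V B'. f v \<noteq> B'}" for v
            using gf[of v B'] B' by (cases "v = w") auto
          then have "{v \<in> V B'. g v \<noteq> B'} = insert w {v \<in> V B'. f v \<noteq> B'}" by blast
          then have "coef V g B' = coef V f B' - 1" using \<open>f w = B'\<close> by (simp add: coef_def)
          then show ?thesis using f(2)[OF B'(1)] 2 by (simp add: b_def)
        next
          case 3
          have "g w \<noteq> B" "f w \<noteq> B" using gw C'(5) 3 \<open>f w = B'\<close> by auto
          then have "v \<in> {v \<in> V B. g v \<noteq> B} \<longleftrightarrow> v \<in> {v \<in> V B. f v \<noteq> B}" for v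
            using gf[of v B] 3(1) by (cases "v = w") auto
          then have "{v \<in> V B. g v \<noteq> B} = {v \<in> V B. f v \<noteq> B}" by blast
          then have "coef V g B = coef V f B" by (simp add: coef_def)
          then show ?thesis using f(2)[OF 3(1)] 3 by (simp add: b_def)
        qed
      qed
      ultimately show ?thesis by blast
    qed
  qed
qed

text \<open>
  Since \<open>x\<close> is largest on selected blocks, every component of its support is closed under \<open>f\<close>, and
  subtracting the minimum of \<open>x\<close> on a component preserves the hypotheses.
\<close>

lemma conic_decomposition:
  fixes x :: "'b \<Rightarrow> real"
  assumes f: "selector V f Bs" and "\<And>B. x B \<ge> 0" "\<And>B. B \<notin> Bs \<Longrightarrow> x B = 0"
    and "\<And>B v. B \<in> Bs \<Longrightarrow> v \<in> V B \<Longrightarrow> x B \<le> x (f v)"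
  shows "\<exists>w. (\<forall>A. w A \<ge> 0) \<and> (\<forall>A. w A \<noteq> 0 \<longrightarrow> A \<subseteq> Bs \<and> A \<noteq> {} \<and> linked V A \<and> selector V f A) \<and>
    (\<forall>B. x B = (\<Sum>A\<in>UNIV. w A * indicator A B))"
  using assms(2-4)
proof (induction "card {B. x B \<noteq> 0}" arbitrary: x rule: less_induct)
  case less
  define S where "S = {B. x B \<noteq> 0}"
  have pos: "x B > 0" if "B \<in> S" for B using that less.prems(1)[of B] by (auto simp: S_def)
  have SB: "S \<subseteq> Bs" using less.prems(2) by (auto simp: S_def)
  show ?case
  proof (cases "S = {}")
    case True
    then show ?thesis by (intro exI[of _ "\<lambda>_. 0"]) (auto simp: S_def)
  next
    case False
    then obtain C where C: "uncut V C S" "C \<noteq> {}" "linked V C" using linked_component[of S] by auto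
    have CS: "C \<subseteq> S" using C by (auto simp: uncut_def)
    have in_C: "E \<in> C" if "B \<in> C" "v \<in> V B" "v \<in> V E" "E \<in> S" for B E v
      using C(1) that unfolding uncut_def by blast
    have fC: "f v \<in> C" "v \<in> V (f v)" if "B \<in> C" "v \<in> V B" for B v
    proof -
      have "B \<in> Bs" using that CS SB by auto
      then show "v \<in> V (f v)" using f that by (auto simp: selector_def)
      have "0 < x (f v)" using pos[of B] less.prems(3)[OF \<open>B \<in> Bs\<close> that(2)] that CS by auto
      then have "f v \<in> S" by (simp add: S_def)
      then show "f v \<in> C" using in_C[OF that \<open>v \<in> V (f v)\<close>] by simp
    qed
    \<comment> \<open>Subtracting the minimum removes at least one block from the support, which
      drives the induction.\<close>
    define t where "t = Min (x ` C)"
    have t: "t \<in> x ` C" "\<And>B. B \<in> C \<Longrightarrow> t \<le> x B" using C(2) by (auto simp: t_def)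
    have "t > 0" using t(1) pos CS by auto
    define y where "y B = x B - t * indicator C B" for B
    have y: "y B = (if B \<in> C then x B - t else x B)" for B by (simp add: y_def)
    have "{B. y B \<noteq> 0} \<subset> {B. x B \<noteq> 0}"
    proof
      show "{B. y B \<noteq> 0} \<subseteq> {B. x B \<noteq> 0}" using CS by (auto simp: y S_def split: if_splits)
      obtain B where "B \<in> C" "x B = t" using t(1) by auto
      then have "y B = 0" "x B \<noteq> 0" using CS by (auto simp: y S_def)
      then show "{B. y B \<noteq> 0} \<noteq> {B. x B \<noteq> 0}" by blast
    qed
    then have "card {B. y B \<noteq> 0} < card {B. x B \<noteq> 0}" by (intro psubset_card_mono) auto
    moreover have "y B \<ge> 0" for B using t(2) less.prems(1) by (auto simp: y)
    moreover have "y B = 0" if "B \<notin> Bs" for B using that less.prems(2) CS SB by (auto simp: y)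
    moreover have "y B \<le> y (f v)" if B: "B \<in> Bs" "v \<in> V B" for B v
    proof (cases "B \<in> C")
      case True
      then show ?thesis using fC[of B v] B less.prems(3)[OF B] by (simp add: y)
    next
      case nC: False
      show ?thesis
      proof (cases "B \<in> S")
        case True
        have "v \<in> V (f v)" using f B by (auto simp: selector_def)
        \<comment> \<open>Otherwise \<open>B\<close>, meeting \<open>f v\<close> in
          \<open>v\<close>, would belong to the component \<open>C\<close> too. Hence both sides of
          the comparison are unchanged.\<close>
        then have "f v \<notin> C" using nC in_C[of "f v" v B] True B by blast
        then show ?thesis using nC less.prems(3)[OF B] by (simp add: y)
      next
        case False
        then have "y B = 0" using nC by (simp add: y S_def)
        then show ?thesis using \<open>\<And>B. y B \<ge> 0\<close> by simp
      qed
    qed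
    ultimately obtain w where w: "\<And>A. w A \<ge> 0"
      "\<And>A. w A \<noteq> 0 \<Longrightarrow> A \<subseteq> Bs \<and> A \<noteq> {} \<and> linked V A \<and> selector V f A"
      "\<And>B. y B = (\<Sum>A\<in>UNIV. w A * indicator A B)"
      using less.hyps[of y] by blast
    have "selector V f C" using fC by (auto simp: selector_def)
    moreover have "x B = (\<Sum>A\<in>UNIV. (w(C := w C + t)) A * indicator A B)" for B
    proof -
      have "(\<Sum>A\<in>UNIV. (w(C := w C + t)) A * indicator A B)
          = (\<Sum>A\<in>UNIV. w A * indicator A B + (if A = C then t * indicator C B else 0))"
        by (intro sum.cong) (auto simp: algebra_simps)
      also have "\<dots> = y B + t * indicator C B"
        by (simp add: sum.distrib w(3))
      finally show ?thesis by (simp add: y_def)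
    qed
    moreover have "C \<subseteq> Bs" using CS SB by auto
    ultimately show ?thesis using w(1,2) \<open>t > 0\<close> C(2,3)
      by (intro exI[of _ "w(C := w C + t)"]) (auto simp: add_nonneg_nonneg less_imp_le)
  qed
qed


section \<open>Independent blocks inequalities as selector inequalities\<close>

definition link_hull :: "'b set \<Rightarrow> 'b set" where
  "link_hull A = (LEAST C. A \<subseteq> C \<and> C \<subseteq> Bs \<and> linked V C)"

text \<open>Linked sets are closed under intersection, so one of minimal cardinality above
  \<open>A\<close> is the least one.\<close>

lemma link_hull:
  assumes "A \<subseteq> Bs"
  shows "A \<subseteq> link_hull A" "link_hull A \<subseteq> Bs" "linked V (link_hull A)"
    and "\<And>C. A \<subseteq> C \<Longrightarrow> C \<subseteq> Bs \<Longrightarrow> linked V C \<Longrightarrow> link_hull A \<subseteq> C"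
proof -
  define P where "P C \<longleftrightarrow> A \<subseteq> C \<and> C \<subseteq> Bs \<and> linked V C" for C
  have "P Bs" using assms linked_all by (simp add: P_def)
  then obtain K where K: "P K" "\<And>C. P C \<Longrightarrow> card K \<le> card C"
    using ex_has_least_nat[of P Bs card] by metis
  have least: "K \<subseteq> C" if C: "P C" for C
  proof -
    have "P (K \<inter> C)" using K(1) C linked_Int by (auto simp: P_def)
    then have "card K \<le> card (K \<inter> C)" by (rule K(2))
    then have "K \<inter> C = K" by (intro card_seteq) auto
    then show ?thesis by blast
  qed
  have "link_hull A = K"
    unfolding link_hull_def P_def[symmetric] by (rule Least_equality) (use K(1) least in auto)
  then show "A \<subseteq> link_hull A" "link_hull A \<subseteq> Bs" "linked V (link_hull A)"
    and "\<And>C. A \<subseteq> C \<Longrightarrow> C \<subseteq> Bs \<Longrightarrow> linked V C \<Longrightarrow> link_hull A \<subseteq> C"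
    using K(1) least by (auto simp: P_def)
qed

definition indep_ineq :: "'b set \<Rightarrow> ('b \<Rightarrow> real) \<Rightarrow> bool" where
  "indep_ineq I a \<longleftrightarrow> I \<subseteq> Bs \<and> (\<forall>B \<in> I. \<forall>C \<in> I. B \<noteq> C \<longrightarrow> V B \<inter> V C = {}) \<and>
     (\<forall>B \<in> Bs - link_hull I. a B = 0) \<and> (\<forall>B \<in> I. a B = 1) \<and>
     (\<forall>B \<in> link_hull I - I. a B \<in> \<int> \<and> a B \<le> 0) \<and>
     sum a (link_hull I - I) = - (real (card I) - 1) \<and>
     (\<forall>J \<subseteq> I. sum a (link_hull J - I) \<le> - (real (card J) - 1))"

lemma sum_split_ones:
  fixes a :: "'b \<Rightarrow> real"
  assumes "\<And>B. B \<in> I \<Longrightarrow> a B = 1"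
  shows "sum a C = real (card (C \<inter> I)) + sum a (C - I)"
proof -
  have "sum a C = sum a (C \<inter> I) + sum a (C - I)" by (rule sum.Int_Diff) simp
  moreover have "sum a (C \<inter> I) = (\<Sum>B\<in>C \<inter> I. 1)" using assms by (intro sum.cong) auto
  ultimately show ?thesis by simp
qed

lemma indep_ineq_nonpos: "indep_ineq I a \<Longrightarrow> B \<in> Bs - I \<Longrightarrow> a B \<le> 0"
  unfolding indep_ineq_def by (cases "B \<in> link_hull I") auto

text \<open>The hull of the members of \<open>I\<close> in \<open>C\<close> stays inside
  \<open>C\<close>. The condition for this subfamily bounds its part of the sum, and the remaining
  terms are nonpositive.\<close>

lemma indep_ineq_sum_le:
  assumes I: "indep_ineq I a" and C: "C \<subseteq> Bs" "linked V C"
  shows "sum a C \<le> 1"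
proof -
  let ?H = "link_hull (C \<inter> I)"
  have H: "?H \<subseteq> C" using link_hull(4)[of "C \<inter> I" C] C by auto
  have "sum a C = real (card (C \<inter> I)) + sum a (C - I)"
    using I by (intro sum_split_ones) (simp add: indep_ineq_def)
  also have "sum a (C - I) = sum a (C - I - (?H - I)) + sum a (?H - I)"
    using H by (intro sum.subset_diff) auto
  also have "sum a (C - I - (?H - I)) \<le> 0"
    using C(1) indep_ineq_nonpos[OF I] by (intro sum_nonpos) auto
  also have "sum a (?H - I) \<le> - (real (card (C \<inter> I)) - 1)"
    using I by (auto simp: indep_ineq_def)
  finally show ?thesis by simp
qed

lemma indep_ineq_total:
  assumes "indep_ineq I a"
  shows "sum a Bs = 1"
proof -
  have I: "I \<subseteq> Bs" using assms by (simp add: indep_ineq_def)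
  have "sum a Bs = sum a (link_hull I)"
    using assms link_hull(2)[OF I] by (intro sum.mono_neutral_right) (auto simp: indep_ineq_def)
  also have "\<dots> = real (card (link_hull I \<inter> I)) + sum a (link_hull I - I)"
    using assms by (intro sum_split_ones) (simp add: indep_ineq_def)
  also have "link_hull I \<inter> I = I" using link_hull(1)[OF I] by auto
  finally show ?thesis using assms by (simp add: indep_ineq_def)
qed

lemma indep_ineq_eq_coef:
  assumes "indep_ineq I a"
  shows "Bs \<noteq> {}" "\<exists>f. selector V f Bs \<and> (\<forall>B \<in> Bs. a B = coef V f B)"
proof -
  show "Bs \<noteq> {}" using indep_ineq_total[OF assms] by auto
  moreover have "a B \<in> \<int>" if "B \<in> Bs" for B
    using assms that by (cases "B \<in> I"; cases "B \<in> link_hull I") (auto simp: indep_ineq_def)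
  ultimately show "\<exists>f. selector V f Bs \<and> (\<forall>B \<in> Bs. a B = coef V f B)"
    using indep_ineq_total[OF assms] indep_ineq_sum_le[OF assms] linked_all
    by (intro integral_eq_coef) auto
qed

lemma coef_eq_1: "coef V f B = 1 \<longleftrightarrow> (\<forall>v \<in> V B. f v = B)"
  by (auto simp: coef_def)

lemma coef_le_0: "coef V f B \<noteq> 1 \<Longrightarrow> coef V f B \<le> 0"
  by (auto simp: coef_def Suc_le_eq card_gt_0_iff)

text \<open>Blocks of coefficient 1 are those selected by all their vertices, which makes them
  pairwise disjoint. The other conditions follow from the bound 1 on linked sets and the total
  1.\<close>

lemma indep_ineq_coef:
  assumes f: "selector V f Bs" and ne: "Bs \<noteq> {}"
  shows "indep_ineq {B \<in> Bs. coef V f B = 1} (\<lambda>B. if B \<in> Bs then coef V f B else 0)"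
proof -
  define I where "I = {B \<in> Bs. coef V f B = 1}"
  define a where "a B = (if B \<in> Bs then coef V f B else 0)" for B
  have sum_a: "sum a C = sum (coef V f) C" if "C \<subseteq> Bs" for C
    using that by (intro sum.cong) (auto simp: a_def)
  have le: "sum a C \<le> 1" if "C \<subseteq> Bs" "linked V C" for C
    using sum_coef_le[OF that, of f] sum_a[OF that(1)] by (cases "C = {}") auto
  have total: "sum a Bs = 1" using sum_coef_selector[OF _ linked_all ne f] sum_a by simp
  have IB: "I \<subseteq> Bs" and a1: "\<And>B. B \<in> I \<Longrightarrow> a B = 1" by (auto simp: I_def a_def)
  have a0: "a B \<le> 0" if "B \<in> Bs - I" for B using that coef_le_0 by (auto simp: I_def a_def)
  note H = link_hull[OF IB]
  have "sum a Bs = sum a (Bs - link_hull I) + sum a (link_hull I)"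
    using H(2) by (intro sum.subset_diff) auto
  moreover have "sum a (Bs - link_hull I) \<le> 0"
    using a0 H(1) by (intro sum_nonpos) auto
  \<comment> \<open>The hull contributes at most 1 and the rest is nonpositive, so a total of 1
    forces equality in both. Nonpositive terms with sum 0 then vanish one by one.\<close>
  ultimately have hull1: "sum a (link_hull I) = 1" and out: "sum a (Bs - link_hull I) = 0"
    using total le[OF H(2,3)] by auto
  have "a B = 0" if "B \<in> Bs - link_hull I" for B
  proof -
    have "(\<Sum>B\<in>Bs - link_hull I. - a B) = 0" using out by (simp add: sum_negf)
    then have "\<forall>B \<in> Bs - link_hull I. - a B = 0"
      using a0 H(1) by (subst (asm) sum_nonneg_eq_0_iff) auto
    then show ?thesis using that by simp
  qed
  moreover have "a B \<in> \<int> \<and> a B \<le> 0" if "B \<in> link_hull I - I" for B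
    using that a0 H(2) by (auto simp: a_def coef_def)
  moreover have "sum a (link_hull I - I) = - (real (card I) - 1)"
  proof -
    have "link_hull I \<inter> I = I" using H(1) by auto
    then show ?thesis using sum_split_ones[of I a "link_hull I"] a1 hull1 by simp
  qed
  moreover have "sum a (link_hull J - I) \<le> - (real (card J) - 1)" if "J \<subseteq> I" for J
  proof -
    have "J \<subseteq> Bs" using that IB by auto
    note HJ = link_hull[OF this]
    \<comment> \<open>The hull of \<open>J\<close> may contain further members of \<open>I\<close>;
      they only strengthen the bound.\<close>
    have "card J \<le> card (link_hull J \<inter> I)" using that HJ(1) by (intro card_mono) auto
    then show ?thesis using sum_split_ones[of I a "link_hull J"] a1 le[OF HJ(2,3)] by simp
  qed
  moreover have "V B \<inter> V C = {}" if "B \<in> I" "C \<in> I" "B \<noteq> C" for B C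
    using that by (auto simp: I_def coef_eq_1)
  ultimately have "indep_ineq I a" using IB a1 by (simp add: indep_ineq_def)
  then show ?thesis unfolding I_def a_def .
qed

text \<open>Each covered vertex selects an incident block where \<open>x\<close> is maximal.\<close>

lemma selector_exists:
  fixes x :: "'b \<Rightarrow> real"
  obtains f where "selector V f Bs" "\<And>B v. B \<in> Bs \<Longrightarrow> v \<in> V B \<Longrightarrow> x B \<le> x (f v)"
proof -
  have "\<exists>E. (E \<in> Bs \<and> v \<in> V E) \<and> (\<forall>B. B \<in> Bs \<and> v \<in> V B \<longrightarrow> x B \<le> x E)"
    if "\<exists>B \<in> Bs. v \<in> V B" for v
  proof -
    let ?N = "{B \<in> Bs. v \<in> V B}"
    have "Max (x ` ?N) \<in> x ` ?N" using that by (intro Max_in) auto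
    then obtain E where "E \<in> ?N" "x E = Max (x ` ?N)" by auto
    then show ?thesis by (intro exI[of _ E]) (auto intro!: Max_ge)
  qed
  then obtain f where "\<And>v. \<exists>B \<in> Bs. v \<in> V B \<Longrightarrow>
      (f v \<in> Bs \<and> v \<in> V (f v)) \<and> (\<forall>B. B \<in> Bs \<and> v \<in> V B \<longrightarrow> x B \<le> x (f v))"
    by metis
  then show ?thesis by (intro that[of f]) (auto simp: selector_def)
qed

end

section \<open>The polytope\<close>

text \<open>A dimension count: one point \<open>z\<close> off the face suffices to span the ambient
  space, so the face has codimension at most one, and being proper it has codimension exactly
  one.\<close>

lemma facet_definingI:
  fixes P :: "'v::euclidean_space set"
  assumes "convex P" "P \<subseteq> U" "subspace U" and le: "\<And>x. x \<in> P \<Longrightarrow> a \<bullet> x \<le> b"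
    and z: "z \<in> P" "a \<bullet> z < b" and F: "F = {x \<in> P. a \<bullet> x = b}" "F \<noteq> {}"
    and zero: "0 \<in> insert z F" and span: "U \<subseteq> span (insert z F)"
  shows "facet_defining P (a, b)"
proof -
  have "F = P \<inter> {x. a \<bullet> x = b}" using F by auto
  then have face: "F face_of P"
    using face_of_Int_supporting_hyperplane_le[OF assms(1) le] by simp
  moreover have "z \<notin> F" using z F by simp
  then have "F \<noteq> P" using z by blast
  ultimately have lt: "aff_dim F < aff_dim P" using assms(1) by (intro face_of_aff_dim_lt)
  have "aff_dim P \<le> aff_dim U" using assms(2) by (rule aff_dim_subset)
  also have "\<dots> = int (dim U)" using assms(3) by (rule aff_dim_subspace)
  also have "\<dots> \<le> int (dim (insert z F))" using span by (simp add: dim_mono)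
  \<comment> \<open>The presence of 0 makes linear and affine dimension agree.\<close>
  also have "\<dots> = aff_dim (insert z F)" using zero by (intro aff_dim_zero[symmetric] hull_inc)
  also have "\<dots> \<le> aff_dim F + 1" by (simp add: aff_dim_insert)
  finally have "aff_dim F = aff_dim P - 1" using lt by simp
  then show ?thesis using face F le by (auto simp: facet_defining_def facet_of_def)
qed

text \<open>Moving away from \<open>z\<close> at the barycentre of \<open>Q\<close> leaves \<open>P\<close> only across the constraint \<open>c\<close>.\<close>

lemma irredundantI:
  fixes S :: "('v::euclidean_space \<times> real) set"
  assumes "finite S" "subspace U" and P: "P = {x \<in> U. \<forall>(a, b) \<in> S. a \<bullet> x \<le> b}"
    and c: "(a, b) \<in> S" and z: "z \<in> P" "a \<bullet> z < b"
    and Q: "finite Q" "Q \<noteq> {}" "Q \<subseteq> P" "\<And>q. q \<in> Q \<Longrightarrow> a \<bullet> q = b"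
    and strict: "\<And>a' b'. (a', b') \<in> S - {(a, b)} \<Longrightarrow> \<exists>q \<in> Q. a' \<bullet> q < b'"
  shows "{x \<in> U. \<forall>(a', b') \<in> S - {(a, b)}. a' \<bullet> x \<le> b'} \<noteq> P"
proof -
  define n where "n = real (card Q)"
  have n: "n > 0" using Q by (simp add: n_def card_gt_0_iff)
  \<comment> \<open>Every other constraint is strict at some member of \<open>Q\<close>, hence
    strict at the barycentre, while the constraint \<open>(a, b)\<close> stays tight.\<close>
  define q where "q = (1 / n) *\<^sub>R \<Sum>Q"
  have inner_q: "a' \<bullet> q = (\<Sum>r\<in>Q. a' \<bullet> r) / n" for a' by (simp add: q_def inner_sum_right)
  have aq: "a \<bullet> q = b" using Q(4) n by (simp add: inner_q n_def)
  have qs: "a' \<bullet> q < b'" if c': "(a', b') \<in> S - {(a, b)}" for a' b'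
  proof -
    have "a' \<bullet> r \<le> b'" if "r \<in> Q" for r using Q(3) P c' that by auto
    then have "(\<Sum>r\<in>Q. a' \<bullet> r) < (\<Sum>r\<in>Q. b')"
      using strict[OF c'] Q(1) by (intro sum_strict_mono_ex1) auto
    then show ?thesis using n by (simp add: inner_q n_def field_simps)
  qed
  have "\<forall>\<^sub>F e in at_right 0. e * (fst c' \<bullet> (q - z)) < snd c' - fst c' \<bullet> q"
    if "c' \<in> S - {(a, b)}" for c'
  proof -
    have "((\<lambda>e. e * (fst c' \<bullet> (q - z))) \<longlongrightarrow> 0 * (fst c' \<bullet> (q - z))) (at_right 0)"
      by (intro tendsto_intros)
    moreover have "fst c' \<bullet> q < snd c'" using qs[of "fst c'" "snd c'"] that by simp
    ultimately show ?thesis by (intro order_tendstoD(2)[of _ 0]) auto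
  qed
  then have "\<forall>\<^sub>F e in at_right 0. \<forall>c' \<in> S - {(a, b)}. e * (fst c' \<bullet> (q - z)) < snd c' - fst c' \<bullet> q"
    using assms(1) by (intro eventually_ball_finite ballI) auto
  moreover have "\<forall>\<^sub>F e in at_right (0::real). e > 0" by (simp add: eventually_at_right_less)
  ultimately have "\<forall>\<^sub>F e in at_right 0. e > 0 \<and>
      (\<forall>c' \<in> S - {(a, b)}. e * (fst c' \<bullet> (q - z)) < snd c' - fst c' \<bullet> q)"
    by eventually_elim auto
  then have "\<exists>e. e > 0 \<and> (\<forall>c' \<in> S - {(a, b)}. e * (fst c' \<bullet> (q - z)) < snd c' - fst c' \<bullet> q)"
    by (rule eventually_happens'[OF trivial_limit_at_right_real])
  then obtain e where e: "e > 0"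
    "\<And>c'. c' \<in> S - {(a, b)} \<Longrightarrow> e * (fst c' \<bullet> (q - z)) < snd c' - fst c' \<bullet> q" by blast
  define y where "y = q + e *\<^sub>R (q - z)"
  have "Q \<subseteq> U" "z \<in> U" using Q(3) z P by auto
  then have "y \<in> U" using assms(2)
    unfolding y_def q_def by (intro subspace_add subspace_scale subspace_diff subspace_sum) auto
  moreover have "a' \<bullet> y \<le> b'" if "(a', b') \<in> S - {(a, b)}" for a' b'
    using e(2)[OF that] by (simp add: y_def inner_add_right)
  moreover have "a \<bullet> y > b"
    using e(1) z(2) aq by (simp add: y_def inner_add_right inner_diff_right)
  then have "y \<notin> P" using P c by fastforce
  ultimately show ?thesis by blast
qed

section \<open>The blocks of a connected graph form a hypertree\<close>

context
  fixes G :: "'a::finite ugraph"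
  assumes G: "simple_graph G" "connected_graph G"
begin

text \<open>Every edge lies within one block, so a walk starting in an uncut set stays on its
  vertices. Conversely, each block is connected, so the blocks reachable from \<open>u\<close> form
  an uncut set.\<close>

lemma connected_union_iff:
  assumes A: "A \<subseteq> blocks G"
  shows "connected_graph (union_of_blocks A) \<longleftrightarrow> linked fst A"
proof
  let ?E = "edges (union_of_blocks A)"
  have simple: "simple_graph B" and ns: "nonsep B" if "B \<in> A" for B
    using block_nonsep_subgraph[OF G, of B] A that by (auto simp: subgraph_def)
  {
    assume con: "connected_graph (union_of_blocks A)"
    show "linked fst A"
      unfolding linked_def
    proof (intro allI impI)
      fix T assume T: "uncut fst T A"
      show "T = {} \<or> T = A"
      proof (rule ccontr)
        assume "\<not> (T = {} \<or> T = A)"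
        then obtain B C where BC: "B \<in> T" "C \<in> A" "C \<notin> T" using T by (auto simp: uncut_def)
        then have "B \<in> A" using T by (auto simp: uncut_def)
        have "verts B \<noteq> {}" "verts C \<noteq> {}" using ns[OF \<open>B \<in> A\<close>] ns[OF BC(2)] by (auto simp: nonsep_def)
        then obtain u v where uv: "u \<in> verts B" "v \<in> verts C" by blast
        then have "(u, v) \<in> (adj ?E {})\<^sup>*"
          using con BC(2) \<open>B \<in> A\<close> by (auto simp: connected_graph_iff union_of_blocks_def)
        then have "\<exists>D \<in> T. v \<in> verts D"
        proof (induction rule: rtrancl_induct)
          case base
          then show ?case using uv BC by blast
        next
          case (step x y)
          then obtain D where D: "D \<in> T" "x \<in> verts D" by blast
          obtain K where K: "K \<in> A" "{x, y} \<in> edges K"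
            using step(2) by (auto simp: adj_def union_of_blocks_def)
          have xy: "x \<in> verts K" "y \<in> verts K" using simple_edge_verts[OF simple[OF K(1)] K(2)] by auto
          then have "K \<in> T" using T D K(1) unfolding uncut_def by blast
          then show ?case using xy by blast
        qed
        then show False using T BC uv unfolding uncut_def by blast
      qed
    qed
  next
    assume link: "linked fst A"
    show "connected_graph (union_of_blocks A)"
      unfolding connected_graph_iff
    proof (intro ballI)
      fix u v assume "u \<in> verts (union_of_blocks A)" "v \<in> verts (union_of_blocks A)"
      then obtain B C where BC: "B \<in> A" "u \<in> verts B" "C \<in> A" "v \<in> verts C"
        by (auto simp: union_of_blocks_def)
      have inside: "(x, y) \<in> (adj ?E {})\<^sup>*" if "D \<in> A" "x \<in> verts D" "y \<in> verts D" for D x y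
        using nonsepD[OF ns[OF that(1)], of "{}" x y] that
        by (auto intro!: adj_rtrancl_mono[of x y "edges D"] simp: union_of_blocks_def)
      define T where "T = {D \<in> A. \<forall>x \<in> verts D. (u, x) \<in> (adj ?E {})\<^sup>*}"
      have "uncut fst T A"
        unfolding uncut_def
      proof (intro conjI ballI)
        fix D E assume DE: "D \<in> T" "E \<in> A - T"
        show "verts D \<inter> verts E = {}"
        proof (rule ccontr)
          assume "verts D \<inter> verts E \<noteq> {}"
          then obtain x where x: "x \<in> verts D" "x \<in> verts E" by blast
          have "(u, y) \<in> (adj ?E {})\<^sup>*" if "y \<in> verts E" for y
            using inside[of E x y] x that DE by (auto simp: T_def intro: rtrancl_trans)
          then show False using DE by (auto simp: T_def)
        qed
      qed (auto simp: T_def)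
      moreover have "B \<in> T" using BC inside by (auto simp: T_def)
      ultimately have "T = A" using link by (auto simp: linked_def)
      then show "(u, v) \<in> (adj ?E {})\<^sup>*" using BC by (auto simp: T_def)
    qed
  }
qed

lemma hypertree_blocks: "hypertree (blocks G) fst"
proof
  show "verts B \<noteq> {}" if "B \<in> blocks G" for B
    using block_nonsep_subgraph(1)[OF G that] by (auto simp: nonsep_def)
  show "v = w" if "S \<subseteq> blocks G" "linked fst S" "B \<in> blocks G" "B \<notin> S"
    "v \<in> verts B" "v \<in> \<Union>(verts ` S)" "w \<in> verts B" "w \<in> \<Union>(verts ` S)" for S B v w
    using block_attach[OF G that(1) _ that(3-6) that(7,8)] connected_union_iff that by blast
  \<comment> \<open>The blocks cover all edges, so walks of \<open>G\<close> stay available. For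
    vertices there is only an inclusion, since a one-vertex graph has no blocks.\<close>
  have "verts (union_of_blocks (blocks G)) \<subseteq> verts G" "edges (union_of_blocks (blocks G)) = edges G"
    using block_union_subgraph[OF G, of "blocks G"] edge_in_block[OF G]
    by (auto simp: union_of_blocks_def)
  then have "connected_graph (union_of_blocks (blocks G))"
    using G(2) by (auto simp: connected_graph_iff)
  then show "linked fst (blocks G)" using connected_union_iff by blast
qed

interpretation H: hypertree "blocks G" fst
  by (rule hypertree_blocks)

lemma block_closure_eq: "block_closure G A = H.link_hull A"
proof -
  have "(A \<subseteq> C \<and> C \<subseteq> blocks G \<and> connected_graph (union_of_blocks C)) \<longleftrightarrow>
      (A \<subseteq> C \<and> C \<subseteq> blocks G \<and> linked fst C)" for C
    using connected_union_iff by blast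
  then show ?thesis by (simp add: block_closure_def H.link_hull_def)
qed

lemma independent_blocks_inequality_iff:
  "independent_blocks_inequality G I \<alpha> \<longleftrightarrow> \<alpha> \<in> block_space G \<and> H.indep_ineq I (($) \<alpha>)"
  unfolding independent_blocks_inequality_def independent_blocks_def H.indep_ineq_def block_closure_eq
  by (simp only: conj_ac)

definition coef_vec :: "('a \<Rightarrow> 'a ugraph) \<Rightarrow> real ^ 'a ugraph" where
  "coef_vec f = (\<chi> B. if B \<in> blocks G then coef fst f B else 0)"

text \<open>Distinct selectors may give the same vector. Without blocks there is no inequality, as
  the coefficients of one add up to 1.\<close>

lemma independent_blocks_inequality_coef_vec:
  "(\<exists>I. independent_blocks_inequality G I \<alpha>) \<longleftrightarrow>
     blocks G \<noteq> {} \<and> (\<exists>f. selector fst f (blocks G) \<and> \<alpha> = coef_vec f)"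
proof
  assume "\<exists>I. independent_blocks_inequality G I \<alpha>"
  then obtain I where I: "\<alpha> \<in> block_space G" "H.indep_ineq I (($) \<alpha>)"
    by (auto simp: independent_blocks_inequality_iff)
  obtain f where f: "selector fst f (blocks G)" "\<forall>B \<in> blocks G. \<alpha> $ B = coef fst f B"
    using H.indep_ineq_eq_coef(2)[OF I(2)] by blast
  have "\<alpha> = coef_vec f" using f(2) I(1) by (simp add: vec_eq_iff coef_vec_def block_space_def)
  then show "blocks G \<noteq> {} \<and> (\<exists>f. selector fst f (blocks G) \<and> \<alpha> = coef_vec f)"
    using f(1) H.indep_ineq_eq_coef(1)[OF I(2)] by blast
next
  assume "blocks G \<noteq> {} \<and> (\<exists>f. selector fst f (blocks G) \<and> \<alpha> = coef_vec f)"
  then obtain f where f: "blocks G \<noteq> {}" "selector fst f (blocks G)" "\<alpha> = coef_vec f" by blast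
  have "(($) \<alpha>) = (\<lambda>B. if B \<in> blocks G then coef fst f B else 0)" by (simp add: f(3) coef_vec_def fun_eq_iff)
  then show "\<exists>I. independent_blocks_inequality G I \<alpha>"
    using H.indep_ineq_coef[OF f(2,1)]
    by (auto simp: independent_blocks_inequality_iff f(3) coef_vec_def block_space_def)
qed

lemma CBP_system_eq:
  "CBP_system G = {(coef_vec f, 1) | f. blocks G \<noteq> {} \<and> selector fst f (blocks G)} \<union>
     {(- axis B 1, 0) | B. B \<in> blocks G}"
  unfolding CBP_system_def independent_blocks_inequality_coef_vec by blast

text \<open>Finiteness allows a common step length for all constraints in
  \<open>irredundantI\<close>.\<close>

lemma finite_CBP_system: "finite (CBP_system G)"
proof -
  have "CBP_system G \<subseteq> range (\<lambda>f. (coef_vec f, 1)) \<union> range (\<lambda>B. (- axis B 1, 0))"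
    by (auto simp: CBP_system_eq)
  then show ?thesis by (rule finite_subset) simp
qed

lemma subspace_block_space: "subspace (block_space G)"
  by (auto simp: subspace_def block_space_def)

lemma inner_incidence: "a \<bullet> incidence_vector A = (\<Sum>B\<in>A. a $ B)"
proof -
  have "a \<bullet> incidence_vector A = (\<Sum>B\<in>UNIV. if B \<in> A then a $ B else 0)"
    unfolding inner_vec_def incidence_vector_def by (intro sum.cong) auto
  then show ?thesis by (simp add: sum.If_cases)
qed

lemma inner_axis_1: "axis B (1::real) \<bullet> x = x $ B"
  by (simp add: inner_axis')

lemma inner_coef_vec: "A \<subseteq> blocks G \<Longrightarrow> coef_vec f \<bullet> incidence_vector A = (\<Sum>B\<in>A. coef fst f B)"
  unfolding inner_incidence by (intro sum.cong) (auto simp: coef_vec_def)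

lemma CBP_eq: "CBP G = convex hull (incidence_vector ` {A. A \<subseteq> blocks G \<and> linked fst A})"
  unfolding CBP_def using connected_union_iff by (intro arg_cong[of _ _ "(hull) convex"]) auto

lemma incidence_in_CBP: "A \<subseteq> blocks G \<Longrightarrow> linked fst A \<Longrightarrow> incidence_vector A \<in> CBP G"
  unfolding CBP_eq by (intro hull_inc) auto

lemma CBP_inner_le:
  assumes "x \<in> CBP G" "\<And>A. A \<subseteq> blocks G \<Longrightarrow> linked fst A \<Longrightarrow> a \<bullet> incidence_vector A \<le> b"
  shows "a \<bullet> x \<le> b"
proof -
  have "CBP G \<subseteq> {x. a \<bullet> x \<le> b}"
    unfolding CBP_eq by (rule hull_minimal) (use assms(2) convex_halfspace_le in auto)
  then show ?thesis using assms(1) by auto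
qed

lemma CBP_bounds:
  assumes "x \<in> CBP G"
  shows "0 \<le> x $ B" "x $ B \<le> (if B \<in> blocks G then 1 else 0)"
proof -
  have "(- axis B 1) \<bullet> x \<le> 0"
    by (rule CBP_inner_le[OF assms]) (simp add: inner_axis_1 incidence_vector_def)
  then show "0 \<le> x $ B" by (simp add: inner_axis_1)
  have "axis B 1 \<bullet> x \<le> (if B \<in> blocks G then 1 else 0)"
    by (rule CBP_inner_le[OF assms]) (auto simp: inner_axis_1 incidence_vector_def)
  then show "x $ B \<le> (if B \<in> blocks G then 1 else 0)" by (simp add: inner_axis_1)
qed

lemma CBP_subset_block_space: "CBP G \<subseteq> block_space G"
proof
  fix x assume x: "x \<in> CBP G"
  have "x $ B = 0" if "B \<notin> blocks G" for B
    using CBP_bounds[OF x, of B] that by simp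
  then show "x \<in> block_space G" unfolding block_space_def by blast
qed

lemma inner_block_space: "\<alpha> \<in> block_space G \<Longrightarrow> \<alpha> \<bullet> x = (\<Sum>B\<in>blocks G. \<alpha> $ B * x $ B)"
  unfolding inner_vec_def inner_real_def
  by (rule sum.mono_neutral_right) (simp_all add: block_space_def del: split_paired_All)

section \<open>The inequality description\<close>

lemma CBP_subset_polytope: "CBP G \<subseteq> independent_blocks_polytope G"
proof
  fix x assume x: "x \<in> CBP G"
  have "(\<Sum>B\<in>blocks G. \<alpha> $ B * x $ B) \<le> 1" if "independent_blocks_inequality G I \<alpha>" for I \<alpha>
  proof -
    have \<alpha>: "\<alpha> \<in> block_space G" "H.indep_ineq I (($) \<alpha>)"
      using that by (auto simp: independent_blocks_inequality_iff)
    have "\<alpha> \<bullet> x \<le> 1"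
      using H.indep_ineq_sum_le[OF \<alpha>(2)] by (intro CBP_inner_le[OF x]) (auto simp: inner_incidence)
    then show ?thesis by (simp add: inner_block_space[OF \<alpha>(1)])
  qed
  moreover have "x $ B \<le> 1" if "B \<in> blocks G" for B using CBP_bounds(2)[OF x, of B] that by simp
  ultimately show "x \<in> independent_blocks_polytope G"
    using x CBP_subset_block_space CBP_bounds(1)[OF x] by (auto simp: independent_blocks_polytope_def)
qed

lemma polytope_subset_solutions: "independent_blocks_polytope G \<subseteq> solutions G (CBP_system G)"
proof
  fix x assume x: "x \<in> independent_blocks_polytope G"
  have "\<alpha> \<bullet> x \<le> 1" if "independent_blocks_inequality G I \<alpha>" for I \<alpha>
  proof -
    have "\<alpha> \<in> block_space G" using that by (simp add: independent_blocks_inequality_iff)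
    then show ?thesis using x that by (auto simp: inner_block_space independent_blocks_polytope_def)
  qed
  then show "x \<in> solutions G (CBP_system G)"
    using x by (auto simp: independent_blocks_polytope_def solutions_def CBP_system_def inner_axis_1)
qed

text \<open>With \<open>f\<close> chosen maximal for \<open>x\<close>, the conic decomposition of
  \<open>x\<close> has total weight \<open>coef_vec f \<bullet> x\<close>. A single inequality,
  depending on \<open>x\<close>, bounds this weight by 1.\<close>

lemma solutions_subset_CBP: "solutions G (CBP_system G) \<subseteq> CBP G"
proof
  fix x assume "x \<in> solutions G (CBP_system G)"
  then have x: "x \<in> block_space G" "\<And>a b. (a, b) \<in> CBP_system G \<Longrightarrow> a \<bullet> x \<le> b"
    by (auto simp: solutions_def)
  have zero: "x $ B = 0" if "B \<notin> blocks G" for B using that x(1) unfolding block_space_def by blast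
  have nonneg: "x $ B \<ge> 0" for B
  proof (cases "B \<in> blocks G")
    case True
    then have "(- axis B 1, 0) \<in> CBP_system G" unfolding CBP_system_def by blast
    from x(2)[OF this] show ?thesis by (simp add: inner_axis_1)
  qed (simp add: zero)
  obtain f where f: "selector fst f (blocks G)"
    "\<And>B v. B \<in> blocks G \<Longrightarrow> v \<in> verts B \<Longrightarrow> x $ B \<le> x $ f v"
    using H.selector_exists[of "($) x"] by blast
  obtain w where w: "\<And>A. w A \<ge> 0"
      "\<And>A. w A \<noteq> 0 \<Longrightarrow> A \<subseteq> blocks G \<and> A \<noteq> {} \<and> linked fst A \<and> selector fst f A"
      "\<And>B. x $ B = (\<Sum>A\<in>UNIV. w A * indicator A B)"
    using H.conic_decomposition[OF f(1), of "($) x"] nonneg zero f(2) by blast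
  have "x $ B = (\<Sum>A\<in>UNIV. w A *\<^sub>R incidence_vector A) $ B" for B
    unfolding w(3) sum_component by (intro sum.cong) (auto simp: incidence_vector_def)
  then have x_eq: "x = (\<Sum>A\<in>UNIV. w A *\<^sub>R incidence_vector A)"
    unfolding vec_eq_iff by blast
  have "sum w UNIV = coef_vec f \<bullet> x"
  proof -
    \<comment> \<open>Sets of nonzero weight are closed under \<open>f\<close> and hence
      tight.\<close>
    have "w A = w A * (coef_vec f \<bullet> incidence_vector A)" for A
      using w(2)[of A] H.sum_coef_selector[of A f] by (cases "w A = 0") (auto simp: inner_coef_vec)
    then have "sum w UNIV = (\<Sum>A\<in>UNIV. w A * (coef_vec f \<bullet> incidence_vector A))"
      by (rule sum.cong[OF refl])
    then show ?thesis by (simp add: x_eq inner_sum_right)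
  qed
  moreover have "coef_vec f \<bullet> x \<le> 1"
  \<comment> \<open>Without blocks the system contains no such inequality, but then
    \<open>coef_vec f\<close> is zero.\<close>
  proof (cases "blocks G = {}")
    case True
    then show ?thesis by (simp add: coef_vec_def inner_vec_def)
  next
    case False
    then show ?thesis using x(2)[of "coef_vec f" 1] f(1) by (auto simp: CBP_system_eq)
  qed
  ultimately have w1: "sum w UNIV \<le> 1" by simp
  \<comment> \<open>The missing weight goes to the empty set, whose incidence vector is 0.\<close>
  define u where "u = w({} := 1 - sum w UNIV)"
  have w0: "w {} = 0" using w(2)[of "{}"] by blast
  have "sum u UNIV = sum w UNIV - w {} + (1 - sum w UNIV)"
    by (simp add: u_def sum.remove[of UNIV "{}"])
  then have "sum u UNIV = 1" using w0 by simp
  moreover have "x = (\<Sum>A\<in>UNIV. u A *\<^sub>R incidence_vector A)"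
  proof -
    have "incidence_vector ({} :: 'a ugraph set) = 0" by (simp add: vec_eq_iff incidence_vector_def)
    then show ?thesis unfolding x_eq by (intro sum.cong) (auto simp: u_def)
  qed
  moreover have u_nonneg: "u A \<ge> 0" for A using w(1) w1 by (simp add: u_def)
  moreover have u_supp: "A \<subseteq> blocks G \<and> linked fst A" if "u A \<noteq> 0" for A
    using that w(2)[of A] by (cases "A = {}") (auto simp: u_def linked_empty)
  let ?L = "{A. A \<subseteq> blocks G \<and> linked fst A}"
  have "sum u UNIV = sum u ?L"
    by (rule sum.mono_neutral_right) (use u_supp in auto)
  moreover have "(\<Sum>A\<in>UNIV. u A *\<^sub>R incidence_vector A) = (\<Sum>A\<in>?L. u A *\<^sub>R incidence_vector A)"
    by (rule sum.mono_neutral_right) (use u_supp in auto)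
  ultimately show "x \<in> CBP G"
    using convex_sum[of ?L "CBP G" u incidence_vector] incidence_in_CBP
    by (auto simp: CBP_eq)
qed

lemma CBP_eq_solutions: "CBP G = solutions G (CBP_system G)"
  and CBP_eq_polytope: "CBP G = independent_blocks_polytope G"
  using CBP_subset_polytope polytope_subset_solutions solutions_subset_CBP by blast+

section \<open>Facets and irredundancy\<close>

definition tight :: "real ^ 'a ugraph \<Rightarrow> real \<Rightarrow> (real ^ 'a ugraph) set" where
  "tight a b = {x \<in> incidence_vector ` {A. A \<subseteq> blocks G \<and> linked fst A}. a \<bullet> x = b}"

lemma block_space_subset_span:
  assumes "\<And>B. B \<in> blocks G \<Longrightarrow> axis B 1 \<in> span S"
  shows "block_space G \<subseteq> span S"
proof
  fix x assume x: "x \<in> block_space G"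
  have "x = (\<Sum>B\<in>UNIV. x $ B *\<^sub>R axis B 1)"
    using basis_expansion[of x] by (simp add: scalar_mult_eq_scaleR)
  also have "\<dots> = (\<Sum>B\<in>blocks G. x $ B *\<^sub>R axis B 1)"
    using x by (intro sum.mono_neutral_right) (auto simp: block_space_def)
  also have "\<dots> \<in> span S" using assms by (intro span_sum span_scale) auto
  finally show "x \<in> span S" .
qed

text \<open>The tight vector of the closed set generated by \<open>B\<close> is
  \<open>axis B 1\<close> plus unit vectors of blocks that generate strictly smaller closed sets, so
  the system can be solved by induction.\<close>

lemma span_tight_coef_vec:
  assumes f: "selector fst f (blocks G)" and B: "B \<in> blocks G"
  shows "axis B 1 \<in> span (tight (coef_vec f) 1)"
  using B
proof (induction "card (sel_reach fst f B)" arbitrary: B rule: less_induct)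
  case less
  let ?R = "sel_reach fst f B" and ?S = "span (tight (coef_vec f) 1)"
  have R: "?R \<subseteq> blocks G" "linked fst ?R" "selector fst f ?R" "B \<in> ?R"
    using sel_reach_subset[OF f less.prems] linked_sel_reach[OF f less.prems]
      selector_sel_reach[OF f less.prems] sel_reach_self[of B fst f] by auto
  then have "coef_vec f \<bullet> incidence_vector ?R = 1"
    using H.sum_coef_selector[of ?R f] inner_coef_vec by auto
  then have "incidence_vector ?R \<in> tight (coef_vec f) 1" using R by (auto simp: tight_def)
  then have "incidence_vector ?R \<in> ?S" by (rule span_base)
  moreover have "axis D 1 \<in> ?S" if D: "D \<in> ?R - {B}" for D
  proof (rule less.hyps)
    \<comment> \<open>Acyclicity of the selector makes the generated set shrink.\<close>
    have "B \<notin> sel_reach fst f D"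
      using H.sel_reach_antisym[OF _ f less.prems, of D] D by auto
    then have "sel_reach fst f D \<subset> ?R" using sel_reach_trans[of D fst f B] D R(4) by auto
    then show "card (sel_reach fst f D) < card ?R" by (rule psubset_card_mono[rotated]) simp
    show "D \<in> blocks G" using D R by auto
  qed
  then have "(\<Sum>D\<in>?R - {B}. axis D 1) \<in> ?S" by (rule span_sum)
  moreover have "incidence_vector ?R = (\<Sum>D\<in>?R. axis D 1)"
    by (auto simp: vec_eq_iff incidence_vector_def axis_def)
  then have "axis B 1 = incidence_vector ?R - (\<Sum>D\<in>?R - {B}. axis D 1)"
    using R(4) by (simp add: sum.remove)
  ultimately show ?case by (metis span_diff)
qed

lemma convex_CBP: "convex (CBP G)"
  by (simp add: CBP_def)

lemma zero_in_CBP: "0 \<in> CBP G"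
  using incidence_in_CBP[of "{}"] by (simp add: linked_empty incidence_vector_def zero_vec_def)

lemma axis_eq_incidence: "axis B 1 = incidence_vector {B}"
  by (auto simp: vec_eq_iff incidence_vector_def axis_def)

lemma axis_in_CBP: "B \<in> blocks G \<Longrightarrow> axis B 1 \<in> CBP G"
  using incidence_in_CBP[of "{B}"] by (simp add: axis_eq_incidence linked_singleton)

lemma tight_subset: "tight a b \<subseteq> CBP G" "x \<in> tight a b \<Longrightarrow> a \<bullet> x = b"
  using incidence_in_CBP by (auto simp: tight_def)

lemma finite_tight: "finite (tight a b)"
  by (simp add: tight_def)

lemma tight_axis:
  "0 \<in> tight (- axis B 1) 0" "D \<in> blocks G \<Longrightarrow> D \<noteq> B \<Longrightarrow> axis D 1 \<in> tight (- axis B 1) 0"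
proof -
  have "0 = incidence_vector ({} :: 'a ugraph set)" by (simp add: vec_eq_iff incidence_vector_def)
  then show "0 \<in> tight (- axis B 1) 0" by (auto simp: tight_def linked_empty)
  assume "D \<in> blocks G" "D \<noteq> B"
  moreover from this have "axis B (1::real) \<bullet> axis D 1 = 0" by (subst inner_axis_1) (simp add: axis_def)
  ultimately show "axis D 1 \<in> tight (- axis B 1) 0"
    by (auto simp: tight_def axis_eq_incidence[of D] linked_singleton)
qed

lemma CBP_facet_and_irredundant:
  assumes c: "c \<in> CBP_system G"
  shows "facet_defining (CBP G) c" "solutions G (CBP_system G - {c}) \<noteq> CBP G"
proof -
  obtain a b where ab: "c = (a, b)" by force
  have le: "a \<bullet> x \<le> b" if "x \<in> CBP G" for x
    using that c ab by (auto simp: CBP_eq_solutions solutions_def)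
  \<comment> \<open>The data for both criteria at once: a point strictly inside the constraint that
    completes the tight incidence vectors to a spanning set, and these vectors as witnesses that no
    other constraint is tight on all of them.\<close>
  have "\<exists>z. z \<in> CBP G \<and> a \<bullet> z < b \<and> tight a b \<noteq> {} \<and> 0 \<in> insert z (tight a b) \<and>
      block_space G \<subseteq> span (insert z (tight a b)) \<and>
      (\<forall>a' b'. (a', b') \<in> CBP_system G - {(a, b)} \<longrightarrow> (\<exists>q \<in> tight a b. a' \<bullet> q < b'))"
    (is "\<exists>z. ?P z")
  proof -
    have lt: "\<exists>q \<in> tight a b. a' \<bullet> q < b'" if "(a', b') \<in> CBP_system G" "q \<in> tight a b" "a' \<bullet> q \<noteq> b'" for a' b' q
    proof -
      have "a' \<bullet> q \<le> b'"
        using that(1,2) tight_subset(1)[of a b] by (auto simp: CBP_eq_solutions solutions_def)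
      then show ?thesis using that(2,3) by force
    qed
    consider f where "blocks G \<noteq> {}" "selector fst f (blocks G)" "a = coef_vec f" "b = 1"
      | B where "B \<in> blocks G" "a = - axis B 1" "b = 0"
      using c ab by (auto simp: CBP_system_eq)
    then show ?thesis
    proof cases
      case (1 f)
      have span: "block_space G \<subseteq> span (tight a b)"
        using span_tight_coef_vec[OF 1(2)] 1(3,4) by (intro block_space_subset_span) auto
      have ax: "axis B 1 \<in> block_space G" if "B \<in> blocks G" for B
        using axis_in_CBP[OF that] CBP_subset_block_space by auto
      \<comment> \<open>Since the tight vectors span the block space, a vector orthogonal to all of
        them vanishes on the blocks.\<close>
      have orth: "B \<notin> blocks G \<or> x $ B = 0" if "\<And>q. q \<in> tight a b \<Longrightarrow> x \<bullet> q = 0" for x B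
      proof -
        have "orthogonal x y" if "y \<in> span (tight a b)" for y
          using that by (rule orthogonal_to_span) (use \<open>\<And>q. q \<in> tight a b \<Longrightarrow> x \<bullet> q = 0\<close> in \<open>auto simp: orthogonal_def\<close>)
        then have "x \<bullet> axis B 1 = 0" if "B \<in> blocks G" using ax[OF that] span by (auto simp: orthogonal_def)
        then show ?thesis by (auto simp: inner_axis)
      qed
      have ne: "tight a b \<noteq> {}"
      proof
        assume "tight a b = {}"
        then have "axis B (1::real) $ B = 0" if "B \<in> blocks G" for B using orth[of "axis B 1" B] that by auto
        then show False using 1(1) by (auto simp: axis_def)
      qed
      have "\<exists>q \<in> tight a b. a' \<bullet> q < b'" if c': "(a', b') \<in> CBP_system G" "(a', b') \<noteq> (a, b)" for a' b'
      proof (rule ccontr)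
        assume "\<not> ?thesis"
        then have tight': "a' \<bullet> q = b'" if "q \<in> tight a b" for q using lt[OF c'(1) that] by blast
        consider g where "a' = coef_vec g" "b' = 1" | B where "B \<in> blocks G" "a' = - axis B 1" "b' = 0"
          using c'(1) by (auto simp: CBP_system_eq)
        then show False
        proof cases
          case (1 g)
          \<comment> \<open>Equal right-hand sides make the difference orthogonal to the tight
            vectors, so the two inequalities would coincide.\<close>
          have "(a' - a) \<bullet> q = 0" if "q \<in> tight a b" for q
            using tight'[OF that] tight_subset(2)[OF that] 1 \<open>b = 1\<close> by (simp add: inner_diff_left)
          then have "a' $ B = a $ B" for B
            using orth[of "a' - a" B] 1 \<open>a = coef_vec f\<close> by (auto simp: coef_vec_def)
          then show False using c'(2) 1 \<open>b = 1\<close> by (simp add: vec_eq_iff)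
        next
          case (2 B)
          then show False using orth[of a' B] tight' by (auto simp: axis_def)
        qed
      qed
      \<comment> \<open>The origin violates tightness, as the right-hand side is 1.\<close>
      then have "?P 0" using 1 span ne zero_in_CBP span_mono[of "tight a b" "insert 0 (tight a b)"] by auto
      then show ?thesis ..
    next
      case (2 B)
      have "axis D 1 \<in> span (insert (axis B 1) (tight a b))" if "D \<in> blocks G" for D
        using tight_axis(2)[OF that, of B] 2 by (cases "D = B") (auto intro: span_base)
      then have span: "block_space G \<subseteq> span (insert (axis B 1) (tight a b))"
        by (intro block_space_subset_span)
      have "\<exists>q \<in> tight a b. a' \<bullet> q < b'" if c': "(a', b') \<in> CBP_system G" "(a', b') \<noteq> (a, b)" for a' b'
      proof -
        consider g where "a' = coef_vec g" "b' = 1" | D where "D \<in> blocks G" "a' = - axis D 1" "b' = 0"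
          using c'(1) by (auto simp: CBP_system_eq)
        then show ?thesis
        proof cases
          \<comment> \<open>The origin is tight for nonnegativity and strict for every selector
            inequality.\<close>
          case 1
          then show ?thesis using tight_axis(1)[of B] 2 by (intro bexI[of _ 0]) auto
        next
          case (2 D)
          \<comment> \<open>Another unit vector keeps coordinate \<open>B\<close> at 0 while making
            coordinate \<open>D\<close> positive.\<close>
          then have "axis D 1 \<in> tight a b" using tight_axis(2)[of D B] c'(2) \<open>a = - axis B 1\<close> \<open>b = 0\<close> by auto
          then show ?thesis using 2 by (intro bexI[of _ "axis D 1"]) (auto simp: inner_axis_1)
        qed
      qed
      then have "?P (axis B 1)"
        using 2 span axis_in_CBP[OF 2(1)] tight_axis(1)[of B] by (auto simp: inner_axis_1)
      then show ?thesis ..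
    qed
  qed
  then obtain z where z: "z \<in> CBP G" "a \<bullet> z < b" "tight a b \<noteq> {}" "0 \<in> insert z (tight a b)"
      "block_space G \<subseteq> span (insert z (tight a b))"
      "\<And>a' b'. (a', b') \<in> CBP_system G - {(a, b)} \<Longrightarrow> \<exists>q \<in> tight a b. a' \<bullet> q < b'"
    by blast
  let ?F = "{x \<in> CBP G. a \<bullet> x = b}"
  have tF: "tight a b \<subseteq> ?F" using tight_subset by auto
  show "facet_defining (CBP G) c"
    unfolding ab
  proof (rule facet_definingI[OF convex_CBP CBP_subset_block_space subspace_block_space le z(1,2) refl])
    show "?F \<noteq> {}" "0 \<in> insert z ?F" using z(3,4) tF by auto
    show "block_space G \<subseteq> span (insert z ?F)"
      using z(5) span_mono[of "insert z (tight a b)" "insert z ?F"] tF by blast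
  qed
  show "solutions G (CBP_system G - {c}) \<noteq> CBP G"
    unfolding ab solutions_def
  proof (rule irredundantI[OF finite_CBP_system subspace_block_space _ _ z(1,2) finite_tight z(3)])
    show "CBP G = {x \<in> block_space G. \<forall>(a, b)\<in>CBP_system G. a \<bullet> x \<le> b}"
      using CBP_eq_solutions by (simp add: solutions_def)
  qed (use c ab z(6) tight_subset in auto)
qed

end

theorem theorem5p11:
  fixes G :: "'a::finite ugraph"
  assumes "simple_graph G" and "connected_graph G"
  shows "CBP G = independent_blocks_polytope G \<and>
    CBP G = solutions G (CBP_system G) \<and>
    (\<forall>c \<in> CBP_system G. facet_defining (CBP G) c) \<and>
    (\<forall>c \<in> CBP_system G. solutions G (CBP_system G - {c}) \<noteq> CBP G)"
  using CBP_eq_polytope[OF assms] CBP_eq_solutions[OF assms] CBP_facet_and_irredundant[OF assms]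
  by blast

end
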